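(* Let $\mathcal{K}$ be a class of polynomials such that $\mathcal{K}_{\mathrm{SOMS}}\subseteq\mathcal{K}$. Let $I=\{I_1,\dots,I_k\}$ be a $k$-cover of $[n]$ satisfying the running intersection property (RIP). Let $R=(R_1,\dots,R_k)\in\mathbb{R}^k_{++}$. For $j=1,\dots,m$, let $l_j\in[k]$, $g_j\in\mathbb{R}[x_{I_{l_j}}]$, and $U_j>0$ such that $U_j\ge\max\{g_j(x_{I_{l_j}}):\|x_{I_{l_j}}\|\le R_{l_j}\}$, be given. Let $p\in\mathbb{R}[x]=\mathbb{R}[x_1,\dots,x_n]$ be $I$-sparse. If $p(x)>0$ on $\{x\in\mathcal{B}^I_R: g_j(x_{I_{l_j}})\ge 0,\ j=1,\dots,m\}$, then there exist $(2|I_l|+1)$-variate polynomials $\alpha_{j,l}(y_{I_l},z_{I_l},u)\in\mathcal{K}$ for $l=1,\dots,k$ and $j=0,1$, and univariate polynomials $\rho_j(u)\in\mathcal{K}$ for $j=1,\dots,m$, such that $$p(x)=\sum_{l=1}^k\Big[\alpha_{0,l}(x_{I_l}+R_le,\,R_le-x_{I_l},\,R_l^2-\|x_{I_l}\|^2)+\alpha_{1,l}(x_{I_l}+R_le,\,R_le-x_{I_l},\,R_l^2-\|x_{I_l}\|^2)\,(R_l^2-\|x_{I_l}\|^2)\Big]+\sum_{j=1}^m\rho_j(U_j-g_j(x_{I_{l_j}}))\,g_j(x_{I_{l_j}}).$$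
   Context: $[n]=\{1,\dots,n\}$; $\|\cdot\|$ is the Euclidean norm; $e$ is the all-ones vector of appropriate dimension; $\mathbb{R}^k_{++}$ is the set of vectors with strictly positive entries. For $x\in\mathbb{R}^n$ and $J\subseteq[n]$, $x_J\in\mathbb{R}^J$ is the subvector of $x$ with entries $x_i$, $i\in J$, and $\mathbb{R}[x_J]$ is the ring of real polynomials in these variables. A family $I=\{I_1,\dots,I_k\}$ of subsets of $[n]$ is a $k$-cover of $[n]$ if $\bigcup_{l=1}^kI_l=[n]$. It satisfies the running intersection property (RIP) if for all $1\le l\le k-1$ one has $\big(\bigcup_{\ell=1}^{l}I_\ell\big)\cap I_{l+1}\subseteq I_j$ for some $j\le l$. A polynomial $p\in\mathbb{R}[x]$ is $I$-sparse if $p(x)=\sum_{l=1}^kp_l(x_{I_l})$ for some polynomials $p_l\in\mathbb{R}[x_{I_l}]$. The $I$-sparse ball of radius $R$ is $\mathcal{B}^I_R=\{x\in\mathbb{R}^n:\|x_{I_l}\|\le R_l,\ l=1,\dots,k\}$. A class of polynomials $\mathcal{K}$ is a set of real polynomials, understood to contain polynomials in any (finite) number of variables; inclusions between classes are understood for every number of variables. A real polynomial $q$ in variables $w=(w_1,\dots,w_s)$ is a sum of monomial squares (SOMS) if $q(w)=\sum_{\alpha\in A}\lambda_\alpha w^{2\alpha}$ for some finite $A\subseteq\mathbb{N}^s$ and $\lambda_\alpha\ge0$. $\mathcal{K}_{\mathrm{SOMS}}$ denotes the class of all SOMS polynomials (in any number of variables). *)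

theory Defs
  imports "HOL-Library.Poly_Mapping" "HOL-Analysis.L2_Norm"
begin

text \<open>
  Real polynomials in the variables \<open>x\<^sub>i\<close>, \<open>i :: nat\<close>: an element of \<open>nat \<Rightarrow>\<^sub>0 nat\<close> is an
  exponent vector, and the ring structure is that of \<^theory>\<open>HOL-Library.Poly_Mapping\<close>.
  Polynomials in \<open>s\<close> variables are those in \<open>polys_in {1..s}\<close>. A vector of \<open>\<real>\<^sup>n\<close> is a function
  \<open>nat \<Rightarrow> real\<close> of which only the entries with index in \<open>{1..n}\<close> are ever used.
\<close>

type_synonym mpoly = "(nat \<Rightarrow>\<^sub>0 nat) \<Rightarrow>\<^sub>0 real"

definition Const :: "real \<Rightarrow> mpoly" where
  "Const c = Poly_Mapping.single 0 c"

definition Var :: "nat \<Rightarrow> mpoly" where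
  "Var i = Poly_Mapping.single (Poly_Mapping.single i 1) 1"

definition polys_in :: "nat set \<Rightarrow> mpoly set" where
  "polys_in J = {p. \<forall>a \<in> Poly_Mapping.keys p. Poly_Mapping.keys a \<subseteq> J}"

definition eval_with :: "(real \<Rightarrow> 'a::comm_semiring_1) \<Rightarrow> (nat \<Rightarrow> 'a) \<Rightarrow> mpoly \<Rightarrow> 'a" where
  "eval_with c v p = (\<Sum>a \<in> Poly_Mapping.keys p. c (Poly_Mapping.lookup p a) *
     (\<Prod>i \<in> Poly_Mapping.keys a. v i ^ Poly_Mapping.lookup a i))"

definition peval :: "mpoly \<Rightarrow> (nat \<Rightarrow> real) \<Rightarrow> real" where
  "peval p x = eval_with (\<lambda>c. c) x p"

text \<open>
  \<open>psubst q [f\<^sub>1, \<dots>, f\<^sub>s]\<close> is the polynomial \<open>q(f\<^sub>1, \<dots>, f\<^sub>s)\<close>; variables are numbered from 1,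
  list positions from 0. It is meaningful for \<open>q \<in> polys_in {1..s}\<close>.
\<close>

definition psubst :: "mpoly \<Rightarrow> mpoly list \<Rightarrow> mpoly" where
  "psubst q fs = eval_with Const (\<lambda>i. fs ! (i - 1)) q"

definition k_cover :: "nat \<Rightarrow> nat \<Rightarrow> (nat \<Rightarrow> nat set) \<Rightarrow> bool" where
  "k_cover n k I \<longleftrightarrow> (\<Union>l \<in> {1..k}. I l) = {1..n}"

definition RIP :: "nat \<Rightarrow> (nat \<Rightarrow> nat set) \<Rightarrow> bool" where
  "RIP k I \<longleftrightarrow> (\<forall>l. 1 \<le> l \<and> l < k \<longrightarrow>
     (\<exists>j. 1 \<le> j \<and> j \<le> l \<and> (\<Union>i \<in> {1..l}. I i) \<inter> I (l + 1) \<subseteq> I j))"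

definition sparse :: "nat \<Rightarrow> (nat \<Rightarrow> nat set) \<Rightarrow> mpoly \<Rightarrow> bool" where
  "sparse k I p \<longleftrightarrow> (\<exists>q. (\<forall>l \<in> {1..k}. q l \<in> polys_in (I l)) \<and> p = (\<Sum>l = 1..k. q l))"

definition sparse_ball :: "nat \<Rightarrow> (nat \<Rightarrow> nat set) \<Rightarrow> (nat \<Rightarrow> real) \<Rightarrow> (nat \<Rightarrow> real) set" where
  "sparse_ball k I R = {x. \<forall>l \<in> {1..k}. L2_set x (I l) \<le> R l}"

text \<open>
  A class of polynomials is a family \<open>K\<close> in which \<open>K s\<close> collects the members of the class
  regarded as polynomials in \<open>s\<close> variables \<open>w\<^sub>1, \<dots>, w\<^sub>s\<close>. No relation between the different
  \<open>K s\<close> is imposed.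
\<close>

definition poly_class :: "(nat \<Rightarrow> mpoly set) \<Rightarrow> bool" where
  "poly_class K \<longleftrightarrow> (\<forall>s. K s \<subseteq> polys_in {1..s})"

text \<open>The monomial \<open>w\<^sup>2\<^sup>\<alpha>\<close> has exponent vector \<open>\<alpha> + \<alpha>\<close>.\<close>

definition SOMS :: "nat \<Rightarrow> mpoly set" where
  "SOMS s = {q. \<exists>A c. finite A \<and> (\<forall>a \<in> A. Poly_Mapping.keys a \<subseteq> {1..s} \<and> 0 \<le> c a) \<and>
     q = (\<Sum>a \<in> A. Poly_Mapping.single (a + a) (c a))}"

definition ball_poly :: "nat set \<Rightarrow> real \<Rightarrow> mpoly" where
  "ball_poly J r = Const (r\<^sup>2) - (\<Sum>i \<in> J. (Var i)\<^sup>2)"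

text \<open>
  The argument list \<open>(x\<^sub>J + r e, r e - x\<^sub>J, r\<^sup>2 - \<parallel>x\<^sub>J\<parallel>\<^sup>2)\<close> of length \<open>2 |J| + 1\<close> for finite \<open>J\<close>,
  with the entries of \<open>x\<^sub>J\<close> in increasing order of their indices.
\<close>

definition ball_args :: "nat set \<Rightarrow> real \<Rightarrow> mpoly list" where
  "ball_args J r =
     map (\<lambda>i. Var i + Const r) (sorted_list_of_set J) @
     map (\<lambda>i. Const r - Var i) (sorted_list_of_set J) @
     [ball_poly J r]"

end

theory Submission
  imports Defs "HOL-Analysis.Weierstrass_Theorems" "HOL-Analysis.Function_Metric"
begin

text \<open>
  The statement reduces to a single ball in two moves. First, the constraints \<open>g\<^sub>j\<close> are absorbed
  into \<open>p\<close>. The function \<open>(1 - s / U)\<^sup>2\<^sup>N s\<close> is at most \<open>U / (2 N)\<close> for \<open>0 \<le> s \<le> U\<close> and at most \<open>s\<close>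
  for \<open>s < 0\<close>. Hence subtracting large multiples of \<open>(1 - g\<^sub>j / U\<^sub>j)\<^sup>2\<^sup>N g\<^sub>j\<close> from \<open>p\<close> costs almost
  nothing where all \<open>g\<^sub>j\<close> are nonnegative and gains a lot where some \<open>g\<^sub>j\<close> is negative, so that for
  suitable constants the difference is positive on the whole compact sparse ball
  (\<open>compact_even_power_penalty\<close>). The subtracted terms have the form \<open>\<rho>\<^sub>j(U\<^sub>j - g\<^sub>j) g\<^sub>j\<close> with \<open>\<rho>\<^sub>j\<close> a
  single monomial square, and the difference is still sparse.

  Second, a sparse polynomial that is positive on the sparse ball is a sum of polynomials
  \<open>q\<^sub>l(x\<^sub>I\<^sub>l)\<close> each of which is positive on its own ball (\<open>sparse_positive_split\<close>). The blocks are
  split off one after the other. By the running intersection property the last block meets the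
  union of the others inside a single earlier block, so that a polynomial \<open>h\<close> in the common
  variables may be moved between the two summands; a suitable \<open>h\<close> is obtained by inserting a
  continuous function between two bounds and approximating it with the Stone-Weierstrass theorem
  (\<open>separating_polynomial\<close>).

  There remains a polynomial \<open>f\<close> positive on a ball of radius \<open>r\<close>. The polynomials \<open>\<alpha>\<^sub>0 + \<alpha>\<^sub>1 u\<close> with
  \<open>u = r\<^sup>2 - \<parallel>x\<parallel>\<^sup>2\<close> and \<open>\<alpha>\<^sub>0\<close>, \<open>\<alpha>\<^sub>1\<close> sums of monomial squares in \<open>x + r e\<close>, \<open>r e - x\<close>, \<open>u\<close> form a
  semiring \<open>T\<close>, because \<open>u\<^sup>2\<close> is itself a monomial square. The identity
  \<open>(x\<^sub>i + r)\<^sup>2 + u + \<Sum>\<^sub>j\<^sub>\<noteq>\<^sub>i (x\<^sub>j\<^sup>2 + r\<^sup>2) = 2 r (x\<^sub>i + N)\<close>, where \<open>2 N = (d + 1) r\<close> in dimension \<open>d\<close>, and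
  its mirror image show that \<open>T\<close> contains \<open>N \<plusminus> x\<^sub>i\<close>. Another penalty, now with \<open>u\<close> as the
  constraint, replaces \<open>f\<close> by a polynomial positive on the box \<open>[-N, N]\<^sup>d\<close>, and such a polynomial
  has nonnegative coefficients in the Bernstein basis of high degree, whose elements are products of
  the factors \<open>N \<plusminus> x\<^sub>i\<close> (\<open>positive_on_box_in_semiring\<close>). The polynomials \<open>\<alpha>\<close> and
  \<open>\<rho>\<close> obtained in this way are sums of monomial squares and hence members of the class.
\<close>

section \<open>Evaluation and substitution of polynomials\<close>

lemma sum_of_terms: "p = (\<Sum>a \<in> Poly_Mapping.keys p. Poly_Mapping.single a (Poly_Mapping.lookup p a))"
  for p :: mpoly
  by (rule poly_mapping_eqI) (auto simp: lookup_sum lookup_single when_def in_keys_iff)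

text \<open>
  Evaluation at a point and substitution of polynomials are the two instances of one
  homomorphism: the coefficients are mapped by \<open>c\<close> and the variables by \<open>v\<close>.
\<close>

locale evaluation =
  fixes c :: "real \<Rightarrow> 'a::comm_ring_1" and v :: "nat \<Rightarrow> 'a"
  assumes coeff_0: "c 0 = 0" and coeff_1: "c 1 = 1"
    and coeff_add: "c (s + t) = c s + c t" and coeff_mult: "c (s * t) = c s * c t"
begin

definition monomial :: "(nat \<Rightarrow>\<^sub>0 nat) \<Rightarrow> 'a" where
  "monomial a = (\<Prod>i \<in> Poly_Mapping.keys a. v i ^ Poly_Mapping.lookup a i)"

lemma monomial_superset:
  assumes "finite A" "Poly_Mapping.keys a \<subseteq> A"
  shows "monomial a = (\<Prod>i \<in> A. v i ^ Poly_Mapping.lookup a i)"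
  unfolding monomial_def
  by (rule prod.mono_neutral_left) (use assms in \<open>auto simp: in_keys_iff\<close>)

lemma monomial_add: "monomial (a + b) = monomial a * monomial b"
proof -
  let ?A = "Poly_Mapping.keys a \<union> Poly_Mapping.keys b"
  have "monomial (a + b) = (\<Prod>i \<in> ?A. v i ^ Poly_Mapping.lookup (a + b) i)"
    by (rule monomial_superset) (simp, rule keys_add)
  also have "\<dots> = monomial a * monomial b"
    by (simp add: monomial_superset[of ?A] lookup_add power_add prod.distrib)
  finally show ?thesis .
qed

lemma eval_alt: "eval_with c v p = (\<Sum>a \<in> Poly_Mapping.keys p. c (Poly_Mapping.lookup p a) * monomial a)"
  by (simp add: eval_with_def monomial_def)

lemma eval_single: "eval_with c v (Poly_Mapping.single a r) = c r * monomial a"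
  by (simp add: eval_alt coeff_0)

lemma eval_0 [simp]: "eval_with c v 0 = 0"
  by (simp add: eval_alt)

lemma eval_add: "eval_with c v (p + q) = eval_with c v p + eval_with c v q"
  unfolding eval_alt
  by (rule setsum_keys_plus_distrib) (simp_all add: coeff_0 coeff_add algebra_simps)

lemma eval_sum: "eval_with c v (\<Sum>i\<in>A. f i) = (\<Sum>i\<in>A. eval_with c v (f i))"
  by (induction A rule: infinite_finite_induct) (auto simp: eval_add)

lemma eval_mult: "eval_with c v (p * q) = eval_with c v p * eval_with c v q"
proof -
  have "p * q = (\<Sum>a \<in> Poly_Mapping.keys p. \<Sum>b \<in> Poly_Mapping.keys q.
      Poly_Mapping.single (a + b) (Poly_Mapping.lookup p a * Poly_Mapping.lookup q b))"
    by (subst sum_of_terms[of p], subst sum_of_terms[of q]) (simp add: sum_product mult_single)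
  then have "eval_with c v (p * q) = (\<Sum>a \<in> Poly_Mapping.keys p. \<Sum>b \<in> Poly_Mapping.keys q.
      (c (Poly_Mapping.lookup p a) * monomial a) * (c (Poly_Mapping.lookup q b) * monomial b))"
    by (simp add: eval_sum eval_single coeff_mult monomial_add mult_ac)
  then show ?thesis
    by (simp add: eval_alt sum_product)
qed

lemma eval_Const: "eval_with c v (Const r) = c r"
  by (simp add: Const_def eval_single monomial_def)

lemma eval_Var: "eval_with c v (Var i) = v i"
  by (simp add: Var_def eval_single monomial_def coeff_1)

lemma eval_uminus: "eval_with c v (- p) = - eval_with c v p"
  using eval_add[of p "- p"] by (simp add: eq_neg_iff_add_eq_0 add.commute)

lemma eval_diff: "eval_with c v (p - q) = eval_with c v p - eval_with c v q"
  using eval_add[of p "- q"] by (simp add: eval_uminus)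

lemma eval_1: "eval_with c v 1 = 1"
  using eval_Const[of 1] by (simp add: Const_def coeff_1)

lemma eval_prod: "eval_with c v (\<Prod>i\<in>A. f i) = (\<Prod>i\<in>A. eval_with c v (f i))"
  by (induction A rule: infinite_finite_induct) (auto simp: eval_mult eval_1)

lemma eval_power: "eval_with c v (p ^ d) = eval_with c v p ^ d"
  by (induction d) (auto simp: eval_mult eval_1)

lemmas eval_hom = eval_0 eval_1 eval_add eval_sum eval_mult eval_Const eval_Var eval_uminus
  eval_diff eval_prod eval_power

end

lemma Const_0 [simp]: "Const 0 = 0" by (simp add: Const_def)
lemma Const_1 [simp]: "Const 1 = 1" by (simp add: Const_def)
lemma Const_add: "Const (a + b) = Const a + Const b" by (simp add: Const_def single_add)
lemma Const_diff: "Const (a - b) = Const a - Const b" by (simp add: Const_def single_diff)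
lemma Const_uminus: "Const (- a) = - Const a" by (simp add: Const_def single_uminus)
lemma Const_mult: "Const (a * b) = Const a * Const b" by (simp add: Const_def mult_single)
lemma Const_sum: "Const (\<Sum>i\<in>A. f i) = (\<Sum>i\<in>A. Const (f i))"
  by (induction A rule: infinite_finite_induct) (auto simp: Const_add)
lemma Const_prod: "Const (\<Prod>i\<in>A. f i) = (\<Prod>i\<in>A. Const (f i))"
  by (induction A rule: infinite_finite_induct) (auto simp: Const_mult)
lemma Const_power: "Const (a ^ d) = Const a ^ d"
  by (induction d) (auto simp: Const_mult)
lemma Const_of_nat: "Const (real d) = of_nat d"
  by (simp add: Const_def)
lemma Const_numeral: "Const (numeral d) = numeral d"
  by (simp add: Const_def)

lemmas Const_hom = Const_add Const_diff Const_uminus Const_mult Const_sum Const_prod Const_power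

interpretation at_point: evaluation "\<lambda>c. c" x
  rewrites "\<And>p. eval_with (\<lambda>c. c) x p = peval p x" for x
  by unfold_locales (auto simp: peval_def)

interpretation substitution: evaluation Const "\<lambda>i. fs ! (i - 1)"
  rewrites "\<And>p. eval_with Const (\<lambda>i. fs ! (i - 1)) p = psubst p fs" for fs
  by unfold_locales (auto simp: psubst_def Const_hom)

lemmas peval_hom = at_point.eval_hom
lemmas psubst_hom = substitution.eval_hom

lemma peval_cong:
  assumes "p \<in> polys_in J" "\<And>i. i \<in> J \<Longrightarrow> x i = y i"
  shows "peval p x = peval p y"
proof -
  have "(\<Prod>i \<in> Poly_Mapping.keys a. x i ^ Poly_Mapping.lookup a i)
      = (\<Prod>i \<in> Poly_Mapping.keys a. y i ^ Poly_Mapping.lookup a i)"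
    if "a \<in> Poly_Mapping.keys p" for a
    by (rule prod.cong[OF refl]) (use assms that in \<open>force simp: polys_in_def\<close>)
  then show ?thesis
    by (simp add: peval_def eval_with_def)
qed

lemma polys_in_Const [simp]: "Const r \<in> polys_in J"
  by (simp add: polys_in_def Const_def)

lemma polys_in_0 [simp]: "0 \<in> polys_in J"
  by (simp add: polys_in_def)

lemma polys_in_1 [simp]: "1 \<in> polys_in J"
  by (simp add: polys_in_def)

lemma polys_in_Var [simp]: "i \<in> J \<Longrightarrow> Var i \<in> polys_in J"
  by (simp add: polys_in_def Var_def)

lemma polys_in_add [intro]: "p \<in> polys_in J \<Longrightarrow> q \<in> polys_in J \<Longrightarrow> p + q \<in> polys_in J"
  unfolding polys_in_def using keys_add[of p q] by blast

lemma polys_in_diff [intro]: "p \<in> polys_in J \<Longrightarrow> q \<in> polys_in J \<Longrightarrow> p - q \<in> polys_in J"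
  unfolding polys_in_def using keys_diff[of p q] by blast

lemma polys_in_mult [intro]:
  assumes "p \<in> polys_in J" "q \<in> polys_in J"
  shows "p * q \<in> polys_in J"
  unfolding polys_in_def
proof (intro CollectI ballI)
  fix a assume "a \<in> Poly_Mapping.keys (p * q)"
  then obtain b b' where "a = b + b'" "b \<in> Poly_Mapping.keys p" "b' \<in> Poly_Mapping.keys q"
    using keys_mult[of p q] by blast
  then show "Poly_Mapping.keys a \<subseteq> J"
    using assms keys_add[of b b'] unfolding polys_in_def by blast
qed

lemma polys_in_sum [intro]: "(\<And>i. i \<in> A \<Longrightarrow> f i \<in> polys_in J) \<Longrightarrow> (\<Sum>i\<in>A. f i) \<in> polys_in J"
  by (induction A rule: infinite_finite_induct) auto

lemma polys_in_power [intro]: "p \<in> polys_in J \<Longrightarrow> p ^ d \<in> polys_in J"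
  by (induction d) auto

lemma polys_in_mono: "p \<in> polys_in J \<Longrightarrow> J \<subseteq> J' \<Longrightarrow> p \<in> polys_in J'"
  by (auto simp: polys_in_def)

lemma term_as_product:
  "Poly_Mapping.single a r = Const r * (\<Prod>i \<in> Poly_Mapping.keys a. Var i ^ Poly_Mapping.lookup a i)"
proof -
  have pow: "Var i ^ d = Poly_Mapping.single (Poly_Mapping.single i d) 1" for i d
  proof (induction d)
    case (Suc d)
    have "Var i ^ Suc d = Poly_Mapping.single (Poly_Mapping.single i 1 + Poly_Mapping.single i d) 1"
      by (simp add: Suc) (simp add: Var_def mult_single)
    then show ?case by (simp flip: single_add)
  qed simp
  have prod: "(\<Prod>i \<in> A. Poly_Mapping.single (b i) (1::real)) = Poly_Mapping.single (\<Sum>i\<in>A. b i) 1"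
    for A :: "nat set" and b :: "nat \<Rightarrow> nat \<Rightarrow>\<^sub>0 nat"
    by (induction A rule: infinite_finite_induct) (auto simp: mult_single)
  have "(\<Sum>i \<in> Poly_Mapping.keys a. Poly_Mapping.single i (Poly_Mapping.lookup a i)) = a"
    by (rule poly_mapping_eqI) (auto simp: lookup_sum lookup_single when_def in_keys_iff)
  then show ?thesis
    by (simp add: pow prod Const_def mult_single)
qed

lemma polys_in_induct [consumes 1, case_names Const add mult]:
  assumes p: "p \<in> polys_in J"
    and Const: "\<And>r. P (Const r)"
    and add: "\<And>p q. P p \<Longrightarrow> P q \<Longrightarrow> P (p + q)"
    and mult: "\<And>p i. P p \<Longrightarrow> i \<in> J \<Longrightarrow> P (p * Var i)"
  shows "P p"
proof -
  have pow: "P (q * Var i ^ d)" if "P q" "i \<in> J" for q i d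
    using that(1)
  proof (induction d arbitrary: q)
    case (Suc d)
    from Suc.IH[OF mult[OF Suc.prems that(2)]] show ?case by (simp add: mult_ac)
  qed simp
  have "P (Const r * (\<Prod>i \<in> A. Var i ^ e i))" if "A \<subseteq> J" for r A and e :: "nat \<Rightarrow> nat"
    using that
  proof (induction A rule: infinite_finite_induct)
    case (insert i A)
    then have "P ((Const r * (\<Prod>i \<in> A. Var i ^ e i)) * Var i ^ e i)"
      by (intro pow) auto
    with insert.hyps show ?case by (simp add: mult_ac)
  qed (use Const[of r] in auto)
  then have "P (Poly_Mapping.single a (Poly_Mapping.lookup p a))" if "a \<in> Poly_Mapping.keys p" for a
    using p that by (simp add: term_as_product polys_in_def)
  then have "P (\<Sum>a \<in> A. Poly_Mapping.single a (Poly_Mapping.lookup p a))"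
    if "A \<subseteq> Poly_Mapping.keys p" for A
    using that
  proof (induction A rule: infinite_finite_induct)
    case (insert a A)
    then show ?case using add by simp
  qed (use Const[of 0] in auto)
  then show ?thesis
    by (subst sum_of_terms) simp
qed

lemma continuous_on_coordinate: "continuous_on S (\<lambda>x::nat \<Rightarrow> real. x i)"
  by (rule continuous_on_subset[OF continuous_on_product_coordinates]) simp

lemma continuous_on_peval: "continuous_on S (peval p)"
proof -
  have "continuous_on S (\<lambda>x. peval p x)"
    unfolding peval_def eval_with_def
    by (intro continuous_on_sum continuous_on_mult continuous_on_prod continuous_on_power
        continuous_on_const continuous_on_coordinate)
  then show ?thesis by simp
qed

section \<open>Penalties on compact sets\<close>

lemma compact_sublevel:
  fixes f :: "'a::topological_space \<Rightarrow> real"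
  assumes "compact S" "continuous_on S f"
  shows "compact {x \<in> S. f x \<le> c}"
proof -
  have "closedin (top_of_set S) (S \<inter> f -` {..c})"
    by (rule continuous_closedin_preimage) (use assms in auto)
  moreover have "S \<inter> f -` {..c} = {x \<in> S. f x \<le> c}"
    by auto
  ultimately show ?thesis
    using closedin_compact assms(1) by metis
qed

lemma compact_pos_bounded_below:
  fixes f :: "'a::topological_space \<Rightarrow> real"
  assumes "compact S" "continuous_on S f" "\<And>x. x \<in> S \<Longrightarrow> 0 < f x"
  shows "\<exists>\<delta>>0. \<forall>x\<in>S. \<delta> \<le> f x"
proof (cases "S = {}")
  case True
  then show ?thesis using zero_less_one by blast
next
  case False
  then obtain x where "x \<in> S" "\<forall>y \<in> S. f x \<le> f y"
    using continuous_attains_inf assms by blast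
  then show ?thesis using assms(3) by blast
qed

text \<open>
  On the compact set where \<open>f \<le> 0\<close> the function \<open>d\<close> is bounded below by some \<open>\<epsilon> > 0\<close>. Where
  \<open>d \<le> \<epsilon> / 2\<close>, a compact set again, \<open>f\<close> itself is bounded below by a positive number; elsewhere a
  large multiple of \<open>d\<close> outweighs the minimum of \<open>f\<close>.
\<close>

lemma compact_linear_penalty:
  fixes f d :: "'a::topological_space \<Rightarrow> real"
  assumes S: "compact S" and f: "continuous_on S f" and d: "continuous_on S d"
    and d0: "\<And>x. x \<in> S \<Longrightarrow> 0 \<le> d x" and pos: "\<And>x. x \<in> S \<Longrightarrow> d x = 0 \<Longrightarrow> 0 < f x"
  shows "\<exists>\<mu>\<ge>0. \<exists>\<delta>>0. \<forall>x\<in>S. \<delta> \<le> f x + \<mu> * d x"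
proof -
  have sub: "continuous_on {x \<in> S. P x} h" if "continuous_on S h" for P and h :: "'a \<Rightarrow> real"
    by (rule continuous_on_subset[OF that]) auto
  have "\<exists>\<epsilon>>0. \<forall>x \<in> {x \<in> S. f x \<le> 0}. \<epsilon> \<le> d x"
  proof (rule compact_pos_bounded_below[OF compact_sublevel[OF S f] sub[OF d]])
    show "0 < d x" if "x \<in> {x \<in> S. f x \<le> 0}" for x
      using that d0[of x] pos[of x] by fastforce
  qed
  then obtain \<epsilon> where \<epsilon>: "\<epsilon> > 0" "\<And>x. x \<in> S \<Longrightarrow> f x \<le> 0 \<Longrightarrow> \<epsilon> \<le> d x"
    by blast
  have "\<exists>\<delta>>0. \<forall>x \<in> {x \<in> S. d x \<le> \<epsilon> / 2}. \<delta> \<le> f x"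
  proof (rule compact_pos_bounded_below[OF compact_sublevel[OF S d] sub[OF f]])
    show "0 < f x" if "x \<in> {x \<in> S. d x \<le> \<epsilon> / 2}" for x
      using that \<epsilon>(1) \<epsilon>(2)[of x] by fastforce
  qed
  then obtain \<delta> where \<delta>: "\<delta> > 0" "\<And>x. x \<in> S \<Longrightarrow> d x \<le> \<epsilon> / 2 \<Longrightarrow> \<delta> \<le> f x"
    by blast
  obtain M where M: "\<And>x. x \<in> S \<Longrightarrow> \<bar>f x\<bar> \<le> M"
    using compact_imp_bounded[OF compact_continuous_image[OF f S]] by (auto simp: bounded_iff)
  define \<mu> where "\<mu> = 2 * (\<delta> + \<bar>M\<bar>) / \<epsilon>"
  have "\<mu> \<ge> 0"
    using \<epsilon>(1) \<delta>(1) by (simp add: \<mu>_def)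
  moreover have "\<delta> \<le> f x + \<mu> * d x" if x: "x \<in> S" for x
  proof (cases "d x \<le> \<epsilon> / 2")
    case True
    then show ?thesis using \<delta>(2)[OF x] \<open>\<mu> \<ge> 0\<close> d0[OF x] by (smt (verit) mult_nonneg_nonneg)
  next
    case False
    then have "\<mu> * (\<epsilon> / 2) \<le> \<mu> * d x"
      using \<open>\<mu> \<ge> 0\<close> by (intro mult_left_mono) auto
    moreover have "\<mu> * (\<epsilon> / 2) = \<delta> + \<bar>M\<bar>"
      using \<epsilon>(1) by (simp add: \<mu>_def)
    ultimately show ?thesis using M[OF x] by linarith
  qed
  ultimately show ?thesis using \<delta>(1) by blast
qed

text \<open>
  For \<open>0 \<le> s\<close> and \<open>t = s / V\<close>, Bernoulli's inequality gives
  \<open>(1 - t)\<^sup>2\<^sup>N (1 + 2 N t) \<le> (1 - t)\<^sup>2\<^sup>N (1 + t)\<^sup>2\<^sup>N \<le> 1\<close>. For \<open>s < 0\<close> the power is at least 1.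
\<close>

lemma scalar_penalty:
  fixes s V :: real
  assumes "0 < V" "s \<le> V" "0 < N"
  shows "(1 - s / V) ^ (2 * N) * s \<le> V / (2 * real N) - max 0 (- s)"
proof (cases "s \<ge> 0")
  case True
  define t where "t = s / V"
  have t: "0 \<le> t" "t \<le> 1" and s: "s = V * t"
    using assms True by (auto simp: t_def)
  have "(1 - t) ^ (2 * N) * (1 + real (2 * N) * t) \<le> (1 - t) ^ (2 * N) * (1 + t) ^ (2 * N)"
    using t Bernoulli_inequality[of t "2 * N"] by (intro mult_left_mono) auto
  also have "\<dots> = (1 - t\<^sup>2) ^ (2 * N)"
    by (simp add: power_mult_distrib[symmetric] power2_eq_square algebra_simps)
  also have "\<dots> \<le> 1"
    using t by (intro power_le_one) (auto simp: power_le_one)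
  finally have "(1 - t) ^ (2 * N) * t * (2 * real N) \<le> 1"
    using t zero_le_power[of "1 - t" "2 * N"] by (simp add: distrib_left mult_ac del: zero_le_power)
  then have "(1 - t) ^ (2 * N) * t \<le> 1 / (2 * real N)"
    using assms(3) by (simp add: pos_le_divide_eq)
  then have "V * ((1 - t) ^ (2 * N) * t) \<le> V * (1 / (2 * real N))"
    using assms(1) by (intro mult_left_mono) auto
  then show ?thesis
    using True by (simp add: s mult_ac)
next
  case False
  then have "1 \<le> (1 - s / V) ^ (2 * N)"
    using assms(1) by (intro one_le_power) (simp add: divide_nonpos_pos)
  then have "(1 - s / V) ^ (2 * N) * s \<le> 1 * s"
    using False by (intro mult_right_mono_neg) auto
  then have "(1 - s / V) ^ (2 * N) * s \<le> s"
    by simp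
  moreover have "0 < V / (2 * real N)" "max 0 (- s) = - s"
    using assms False by auto
  ultimately show ?thesis by linarith
qed

text \<open>
  The linear penalty for the total constraint violation \<open>d = \<Sum>\<^sub>j max 0 (- g\<^sub>j)\<close> is not polynomial in
  the \<open>g\<^sub>j\<close>. By \<open>scalar_penalty\<close> it may be replaced by one that is, at the price of an error that
  vanishes as \<open>N\<close> grows.
\<close>

lemma compact_even_power_penalty:
  fixes f :: "'a::topological_space \<Rightarrow> real" and g :: "'j \<Rightarrow> 'a \<Rightarrow> real"
  assumes S: "compact S" and f: "continuous_on S f"
    and "finite J" and g: "\<And>j. j \<in> J \<Longrightarrow> continuous_on S (g j)"
    and V: "\<And>j. j \<in> J \<Longrightarrow> 0 < V j" "\<And>j x. j \<in> J \<Longrightarrow> x \<in> S \<Longrightarrow> g j x \<le> V j"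
    and pos: "\<And>x. x \<in> S \<Longrightarrow> (\<And>j. j \<in> J \<Longrightarrow> 0 \<le> g j x) \<Longrightarrow> 0 < f x"
  shows "\<exists>c\<ge>0. \<exists>N. \<forall>x\<in>S. 0 < f x - (\<Sum>j\<in>J. c * (1 - g j x / V j) ^ (2 * N) * g j x)"
proof -
  define d where "d = (\<lambda>x. \<Sum>j\<in>J. max 0 (- g j x))"
  have "continuous_on S d"
    unfolding d_def using g by (intro continuous_intros) auto
  moreover have "0 \<le> d x" for x
    by (auto simp: d_def intro: sum_nonneg)
  moreover have "0 < f x" if "x \<in> S" "d x = 0" for x
  proof (rule pos[OF that(1)])
    fix j assume "j \<in> J"
    then have "max 0 (- g j x) = 0"
      using that(2) \<open>finite J\<close> unfolding d_def by (subst (asm) sum_nonneg_eq_0_iff) auto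
    then show "0 \<le> g j x" by linarith
  qed
  ultimately obtain c \<delta> where c: "c \<ge> 0" and \<delta>: "\<delta> > 0" "\<And>x. x \<in> S \<Longrightarrow> \<delta> \<le> f x + c * d x"
    using compact_linear_penalty[OF S f] by metis
  define W where "W = c * (\<Sum>j\<in>J. V j)"
  obtain N0 :: nat where "W / \<delta> < real N0"
    using reals_Archimedean2 by blast
  define N where "N = Suc N0"
  have N: "W / \<delta> < real N" "0 < N"
    using \<open>W / \<delta> < real N0\<close> by (auto simp: N_def)
  have "W < \<delta> * real N"
    using N(1) \<delta>(1) by (simp add: pos_divide_less_eq mult.commute)
  also have "\<dots> \<le> \<delta> * (2 * real N)"
    using \<delta>(1) by simp
  finally have small: "W / (2 * real N) < \<delta>"
    using N(2) by (simp add: pos_divide_less_eq)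
  have "0 < f x - (\<Sum>j\<in>J. c * (1 - g j x / V j) ^ (2 * N) * g j x)" if x: "x \<in> S" for x
  proof -
    have "(\<Sum>j\<in>J. c * (1 - g j x / V j) ^ (2 * N) * g j x)
        \<le> (\<Sum>j\<in>J. c * (V j / (2 * real N) - max 0 (- g j x)))"
      using scalar_penalty[OF V(1) V(2)[OF _ x] N(2)] c
      by (intro sum_mono) (simp add: mult.assoc mult_left_mono)
    also have "\<dots> = W / (2 * real N) - c * d x"
      by (simp add: W_def d_def sum_subtractf right_diff_distrib sum_distrib_left sum_divide_distrib)
    finally show ?thesis
      using small \<delta>(2)[OF x] by linarith
  qed
  then show ?thesis using c by blast
qed

lemma compact_coordinate_box:
  "compact {x :: nat \<Rightarrow> real. \<forall>i. if i \<in> J then \<bar>x i\<bar> \<le> M else x i = 0}"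
proof -
  let ?X = "\<lambda>i. if i \<in> J then {- M..M} else {0::real}"
  have "compactin (product_topology (\<lambda>i. euclidean) UNIV) (PiE UNIV ?X)"
    by (subst compactin_PiE) auto
  moreover have "PiE UNIV ?X = {x. \<forall>i. if i \<in> J then \<bar>x i\<bar> \<le> M else x i = 0}"
    by (auto simp: PiE_iff abs_le_iff split: if_splits) (smt (verit) singletonD atLeastAtMost_iff)+
  ultimately show ?thesis
    by (simp add: euclidean_product_topology)
qed

section \<open>Semirings of polynomials and sums of monomial squares\<close>

definition nonneg_semiring :: "mpoly set \<Rightarrow> bool" where
  "nonneg_semiring T \<longleftrightarrow> (\<forall>r\<ge>0. Const r \<in> T) \<and> (\<forall>p\<in>T. \<forall>q\<in>T. p + q \<in> T \<and> p * q \<in> T)"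

lemma nonneg_semiring_closed:
  assumes "nonneg_semiring T"
  shows "r \<ge> 0 \<Longrightarrow> Const r \<in> T" "p \<in> T \<Longrightarrow> q \<in> T \<Longrightarrow> p + q \<in> T" "p \<in> T \<Longrightarrow> q \<in> T \<Longrightarrow> p * q \<in> T"
    "p \<in> T \<Longrightarrow> p ^ d \<in> T"
    "(\<And>i. i \<in> A \<Longrightarrow> f i \<in> T) \<Longrightarrow> (\<Sum>i\<in>A. f i) \<in> T" "(\<And>i. i \<in> A \<Longrightarrow> f i \<in> T) \<Longrightarrow> (\<Prod>i\<in>A. f i) \<in> T"
proof -
  have c: "\<And>r. r \<ge> 0 \<Longrightarrow> Const r \<in> T" and a: "\<And>p q. p \<in> T \<Longrightarrow> q \<in> T \<Longrightarrow> p + q \<in> T"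
    and m: "\<And>p q. p \<in> T \<Longrightarrow> q \<in> T \<Longrightarrow> p * q \<in> T"
    using assms by (auto simp: nonneg_semiring_def)
  have 01: "0 \<in> T" "1 \<in> T" using c[of 0] c[of 1] by auto
  show "r \<ge> 0 \<Longrightarrow> Const r \<in> T" "p \<in> T \<Longrightarrow> q \<in> T \<Longrightarrow> p + q \<in> T" "p \<in> T \<Longrightarrow> q \<in> T \<Longrightarrow> p * q \<in> T"
    using c a m by auto
  show "p \<in> T \<Longrightarrow> p ^ d \<in> T"
    by (induction d) (auto simp: m 01)
  show "(\<And>i. i \<in> A \<Longrightarrow> f i \<in> T) \<Longrightarrow> (\<Sum>i\<in>A. f i) \<in> T"
    by (induction A rule: infinite_finite_induct) (auto simp: a 01)
  show "(\<And>i. i \<in> A \<Longrightarrow> f i \<in> T) \<Longrightarrow> (\<Prod>i\<in>A. f i) \<in> T"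
    by (induction A rule: infinite_finite_induct) (auto simp: m 01)
qed

lemma SOMS_term: "Poly_Mapping.keys a \<subseteq> {1..s} \<Longrightarrow> 0 \<le> r \<Longrightarrow> Poly_Mapping.single (a + a) r \<in> SOMS s"
  unfolding SOMS_def by (intro CollectI exI[of _ "{a}"] exI[of _ "\<lambda>_. r"]) auto

lemma SOMS_0: "0 \<in> SOMS s"
  unfolding SOMS_def by (intro CollectI exI[of _ "{}"]) auto

lemma SOMS_add:
  assumes "p \<in> SOMS s" "q \<in> SOMS s"
  shows "p + q \<in> SOMS s"
proof -
  obtain A c where p: "finite A" "\<forall>a \<in> A. Poly_Mapping.keys a \<subseteq> {1..s} \<and> 0 \<le> c a"
     "p = (\<Sum>a \<in> A. Poly_Mapping.single (a + a) (c a))"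
    using assms(1) unfolding SOMS_def by blast
  obtain B d where q: "finite B" "\<forall>a \<in> B. Poly_Mapping.keys a \<subseteq> {1..s} \<and> 0 \<le> d a"
     "q = (\<Sum>a \<in> B. Poly_Mapping.single (a + a) (d a))"
    using assms(2) unfolding SOMS_def by blast
  define e where "e = (\<lambda>a. (if a \<in> A then c a else 0) + (if a \<in> B then d a else 0))"
  have "p = (\<Sum>a \<in> A \<union> B. Poly_Mapping.single (a + a) (if a \<in> A then c a else 0))"
    unfolding p(3) by (rule sum.mono_neutral_cong_left) (use p(1) q(1) in auto)
  moreover have "q = (\<Sum>a \<in> A \<union> B. Poly_Mapping.single (a + a) (if a \<in> B then d a else 0))"
    unfolding q(3) by (rule sum.mono_neutral_cong_left) (use p(1) q(1) in auto)
  ultimately have "p + q = (\<Sum>a \<in> A \<union> B. Poly_Mapping.single (a + a) (e a))"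
    by (simp only: e_def single_add sum.distrib)
  moreover have "\<forall>a \<in> A \<union> B. Poly_Mapping.keys a \<subseteq> {1..s} \<and> 0 \<le> e a"
    using p(2) q(2) by (auto simp: e_def)
  ultimately show ?thesis
    unfolding SOMS_def using p(1) q(1) by blast
qed

lemma SOMS_sum: "(\<And>i. i \<in> A \<Longrightarrow> f i \<in> SOMS s) \<Longrightarrow> (\<Sum>i\<in>A. f i) \<in> SOMS s"
  by (induction A rule: infinite_finite_induct) (auto simp: SOMS_add SOMS_0)

lemma SOMS_mult:
  assumes "p \<in> SOMS s" "q \<in> SOMS s"
  shows "p * q \<in> SOMS s"
proof -
  obtain A c where p: "\<And>a. a \<in> A \<Longrightarrow> Poly_Mapping.keys a \<subseteq> {1..s} \<and> 0 \<le> c a"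
     "p = (\<Sum>a \<in> A. Poly_Mapping.single (a + a) (c a))"
    using assms(1) unfolding SOMS_def by blast
  obtain B d where q: "\<And>a. a \<in> B \<Longrightarrow> Poly_Mapping.keys a \<subseteq> {1..s} \<and> 0 \<le> d a"
     "q = (\<Sum>a \<in> B. Poly_Mapping.single (a + a) (d a))"
    using assms(2) unfolding SOMS_def by blast
  have "p * q = (\<Sum>a \<in> A. \<Sum>b \<in> B. Poly_Mapping.single ((a + b) + (a + b)) (c a * d b))"
    unfolding p(2) q(2) by (simp add: sum_product mult_single add_ac)
  also have "\<dots> \<in> SOMS s"
  proof (intro SOMS_sum SOMS_term)
    fix a b assume "a \<in> A" "b \<in> B"
    then show "0 \<le> c a * d b" "Poly_Mapping.keys (a + b) \<subseteq> {1..s}"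
      using p(1)[of a] q(1)[of b] keys_add[of a b] by auto
  qed
  finally show ?thesis .
qed

lemma nonneg_semiring_SOMS: "nonneg_semiring (SOMS s)"
  using SOMS_term[of 0 s] by (auto simp: nonneg_semiring_def SOMS_add SOMS_mult Const_def)

lemma SOMS_Var_square:
  assumes "t \<in> {1..s}"
  shows "(Var t)\<^sup>2 \<in> SOMS s"
proof -
  have "(Var t)\<^sup>2 = Poly_Mapping.single (Poly_Mapping.single t 1 + Poly_Mapping.single t 1) 1"
    by (simp add: Var_def power2_eq_square mult_single)
  also have "\<dots> \<in> SOMS s"
    by (rule SOMS_term) (use assms in auto)
  finally show ?thesis .
qed

section \<open>Bernstein expansions and positivity on a box\<close>

text \<open>
  The two factors are the barycentric coordinates of \<open>x\<^sub>i\<close> in \<open>[-N, N]\<close>; they play the part of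
  \<open>t\<close> and \<open>1 - t\<close> in the Bernstein polynomials of the unit interval.
\<close>

definition upper_factor :: "real \<Rightarrow> nat \<Rightarrow> mpoly" where
  "upper_factor N i = Const (1 / (2 * N)) * (Const N + Var i)"

definition lower_factor :: "real \<Rightarrow> nat \<Rightarrow> mpoly" where
  "lower_factor N i = Const (1 / (2 * N)) * (Const N - Var i)"

definition bernstein_poly :: "real \<Rightarrow> nat \<Rightarrow> nat \<Rightarrow> nat \<Rightarrow> mpoly" where
  "bernstein_poly N D k i = Const (real (D choose k)) * upper_factor N i ^ k * lower_factor N i ^ (D - k)"

definition grid_point :: "real \<Rightarrow> nat \<Rightarrow> (nat \<Rightarrow> nat) \<Rightarrow> nat \<Rightarrow> real" where
  "grid_point N D k i = 2 * N * (real (k i) / real D) - N"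

text \<open>
  Of all expansions of \<open>h\<close> in the tensor Bernstein basis of degree \<open>D\<close> in each variable, those are
  singled out whose coefficients nearly agree with the values of \<open>h\<close> at the grid points. Positivity
  of \<open>h\<close> on the box then passes to the coefficients.
\<close>

definition bernstein_expansion ::
  "real \<Rightarrow> nat set \<Rightarrow> nat \<Rightarrow> real \<Rightarrow> mpoly \<Rightarrow> ((nat \<Rightarrow> nat) \<Rightarrow> real) \<Rightarrow> bool" where
  "bernstein_expansion N J D \<epsilon> h b \<longleftrightarrow>
     h = (\<Sum>k \<in> PiE J (\<lambda>_. {..D}). Const (b k) * (\<Prod>i\<in>J. bernstein_poly N D (k i) i)) \<and>
     (\<forall>k \<in> PiE J (\<lambda>_. {..D}). \<bar>b k - peval h (grid_point N D k)\<bar> \<le> \<epsilon>)"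

definition bernstein_approximable :: "real \<Rightarrow> nat set \<Rightarrow> mpoly \<Rightarrow> bool" where
  "bernstein_approximable N J h \<longleftrightarrow>
     (\<forall>\<epsilon>>0. \<exists>D0. \<forall>D\<ge>D0. \<exists>b. bernstein_expansion N J D \<epsilon> h b)"

lemma upper_lower_sum: "N > 0 \<Longrightarrow> upper_factor N i + lower_factor N i = 1"
proof -
  assume "N > 0"
  have "upper_factor N i + lower_factor N i = Const (1 / (2 * N)) * (Const N + Const N)"
    by (simp add: upper_factor_def lower_factor_def algebra_simps)
  also have "\<dots> = 1"
    using \<open>N > 0\<close> by (simp flip: Const_add Const_mult)
  finally show ?thesis .
qed

lemma Var_eq_upper_factor: "N > 0 \<Longrightarrow> Var i = Const (2 * N) * upper_factor N i - Const N"
proof -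
  assume "N > 0"
  then have "Const (2 * N) * Const (1 / (2 * N)) = 1"
    by (simp flip: Const_mult)
  then show ?thesis
    by (simp add: upper_factor_def mult.assoc[symmetric])
qed

text \<open>
  Degree elevation: with \<open>s\<close> and \<open>t\<close> for the upper and the lower factor, multiply \<open>s\<^sup>a\<close> by \<open>(s + t)\<^sup>D\<^sup>-\<^sup>a = 1\<close>, expand, and compare coefficients with
  \<open>(D choose k) (k choose a) = (D choose a) (D - a choose k - a)\<close>.
\<close>

lemma upper_factor_power:
  assumes "N > 0" "a \<le> D"
  shows "upper_factor N i ^ a =
    (\<Sum>k\<le>D. Const (real (k choose a) / real (D choose a)) * bernstein_poly N D k i)"
proof -
  let ?u = "upper_factor N i" and ?v = "lower_factor N i"
  have "?u ^ a = ?u ^ a * (?u + ?v) ^ (D - a)"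
    using upper_lower_sum[OF assms(1)] by simp
  also have "\<dots> = (\<Sum>l\<le>D - a. Const (real ((D - a) choose l)) * ?u ^ (l + a) * ?v ^ (D - a - l))"
    by (simp add: binomial_ring sum_distrib_left Const_of_nat power_add mult_ac)
  also have "\<dots> = (\<Sum>k\<in>{a..D}. Const (real ((D - a) choose (k - a))) * ?u ^ k * ?v ^ (D - k))"
    using assms(2)
    by (intro sum.reindex_bij_witness[of _ "\<lambda>k. k - a" "\<lambda>l. l + a"]) (auto simp: diff_diff_left add.commute)
  also have "\<dots> = (\<Sum>k\<in>{a..D}. Const (real (k choose a) / real (D choose a)) * bernstein_poly N D k i)"
  proof (rule sum.cong[OF refl])
    fix k assume k: "k \<in> {a..D}"
    then have "real (D choose k) * real (k choose a) = real (D choose a) * real ((D - a) choose (k - a))"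
      using choose_mult[of a k D] by (simp flip: of_nat_mult)
    then have "real ((D - a) choose (k - a)) = real (k choose a) / real (D choose a) * real (D choose k)"
      using assms(2) by (simp add: field_simps)
    then have "Const (real ((D - a) choose (k - a)))
        = Const (real (k choose a) / real (D choose a)) * Const (real (D choose k))"
      by (simp only: Const_mult)
    then show "Const (real ((D - a) choose (k - a))) * ?u ^ k * ?v ^ (D - k)
        = Const (real (k choose a) / real (D choose a)) * bernstein_poly N D k i"
      by (simp only: bernstein_poly_def mult.assoc)
  qed
  also have "\<dots> = (\<Sum>k\<le>D. Const (real (k choose a) / real (D choose a)) * bernstein_poly N D k i)"
    by (rule sum.mono_neutral_left) (auto simp: binomial_eq_0)
  finally show ?thesis .
qed

text \<open>
  The truncated subtraction on the right is intended: for \<open>k < a\<close> the factor with \<open>j = k\<close> vanishes,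
  as does the left-hand side.
\<close>

lemma binomial_ratio:
  assumes "a \<le> D" "k \<le> D"
  shows "real (k choose a) / real (D choose a) = (\<Prod>j<a. real (k - j) / real (D - j))"
proof (cases "a \<le> k")
  case True
  have "real (k choose a) / real (D choose a) = (\<Prod>j<a. (real (k - j) / real (a - j)) / (real (D - j) / real (a - j)))"
    by (simp only: binomial_altdef_of_nat[OF True, where ?'a = real]
        binomial_altdef_of_nat[OF assms(1), where ?'a = real] prod_dividef atLeast0LessThan)
  also have "\<dots> = (\<Prod>j<a. real (k - j) / real (D - j))"
    by (rule prod.cong) auto
  finally show ?thesis .
next
  case False
  then have "(\<Prod>j<a. real (k - j) / real (D - j)) = 0"
    by (intro prod_zero) auto
  with False show ?thesis by (simp add: binomial_eq_0)
qed

lemma binomial_ratio_le_1: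
  assumes "k \<le> D"
  shows "real (k choose a) / real (D choose a) \<le> 1"
  using binomial_right_mono[OF assms, of a] by (cases "D choose a = 0") (auto simp: divide_simps)

text \<open>
  Each of the \<open>a\<close> factors \<open>(k - j) / (D - j)\<close> differs from \<open>k / D\<close> by at most \<open>a / (D - a)\<close>, and a
  product of numbers in \<open>[0, 1]\<close> changes by at most the sum of the changes of its factors.
\<close>

lemma binomial_ratio_approx:
  assumes "a < D" "k \<le> D"
  shows "\<bar>real (k choose a) / real (D choose a) - (real k / real D) ^ a\<bar> \<le> (real a)\<^sup>2 / (real D - real a)"
proof -
  have "\<bar>(\<Prod>j<a. real (k - j) / real (D - j)) - (\<Prod>j<a. real k / real D)\<bar>
      \<le> (\<Sum>j<a. \<bar>real (k - j) / real (D - j) - real k / real D\<bar>)"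
    using norm_prod_diff[of "{..<a}" "\<lambda>j. real (k - j) / real (D - j)" "\<lambda>j. real k / real D"] assms
    by (simp add: divide_simps)
  also have "\<dots> \<le> (\<Sum>j<a. real a / (real D - real a))"
  proof (rule sum_mono)
    fix j assume "j \<in> {..<a}"
    then have j: "j < a" by simp
    then have D: "real (D - j) = real D - real j" "0 < real D - real j" "real D > 0"
      using assms by auto
    have "\<bar>real (k - j) / real (D - j) - real k / real D\<bar> \<le> real j / (real D - real j)"
    proof (cases "j \<le> k")
      case True
      then have "real (k - j) / real (D - j) - real k / real D
          = - (real j / (real D - real j)) * ((real D - real k) / real D)"
        using D by (simp add: of_nat_diff field_simps)
      moreover have "\<bar>(real D - real k) / real D\<bar> \<le> 1"
        using assms D by (simp add: divide_simps)
      moreover have "\<bar>- (real j / (real D - real j))\<bar> = real j / (real D - real j)"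
        using D by simp
      ultimately show ?thesis
        using D by (simp only: abs_mult) (intro mult_left_le, auto)
    next
      case False
      then have "real k / real D \<le> real j / (real D - real j)"
        using D by (intro frac_le) auto
      then show ?thesis using False by simp
    qed
    also have "\<dots> \<le> real a / (real D - real a)"
      using j assms by (intro frac_le) auto
    finally show "\<bar>real (k - j) / real (D - j) - real k / real D\<bar> \<le> real a / (real D - real a)" .
  qed
  also have "\<dots> = (real a)\<^sup>2 / (real D - real a)"
    by (simp add: power2_eq_square)
  finally show ?thesis
    using assms by (simp add: binomial_ratio)
qed

text \<open>
  The expansion is the product of the one-variable expansions of \<open>upper_factor_power\<close>. Its
  coefficients are products of binomial ratios and converge, uniformly on the grid, to the values
  of the monomial.
\<close>

lemma bernstein_approximable_monomial:
  assumes N: "N > 0" and J: "finite J"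
  shows "bernstein_approximable N J (\<Prod>i\<in>J. upper_factor N i ^ a i)"
  unfolding bernstein_approximable_def
proof (intro allI impI)
  fix \<epsilon> :: real assume \<epsilon>: "\<epsilon> > 0"
  \<comment> \<open>A common bound for the exponents; the degree must exceed it.\<close>
  define m where "m = (\<Sum>i\<in>J. a i)"
  have am: "a i \<le> m" if "i \<in> J" for i
    unfolding m_def using J that by (simp add: member_le_sum)
  define w where "w = real (card J) * (real m)\<^sup>2"
  obtain q :: nat where q: "w / \<epsilon> < real q"
    using reals_Archimedean2 by blast
  show "\<exists>D0. \<forall>D\<ge>D0. \<exists>b. bernstein_expansion N J D \<epsilon> (\<Prod>i\<in>J. upper_factor N i ^ a i) b"
  proof (rule exI[of _ "Suc (m + q)"], intro allI impI)
    fix D assume D: "D \<ge> Suc (m + q)"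
    define r where "r = (\<lambda>i l. real (l choose a i) / real (D choose a i))"
    define b where "b = (\<lambda>k. \<Prod>i\<in>J. r i (k i))"
    have "(\<Prod>i\<in>J. upper_factor N i ^ a i) = (\<Prod>i\<in>J. \<Sum>l\<le>D. Const (r i l) * bernstein_poly N D l i)"
    proof (rule prod.cong[OF refl])
      fix i assume "i \<in> J"
      then have "a i \<le> D"
        using am[of i] D by simp
      then show "upper_factor N i ^ a i = (\<Sum>l\<le>D. Const (r i l) * bernstein_poly N D l i)"
        unfolding r_def by (rule upper_factor_power[OF N])
    qed
    also have "\<dots> = (\<Sum>k \<in> PiE J (\<lambda>_. {..D}). \<Prod>i\<in>J. Const (r i (k i)) * bernstein_poly N D (k i) i)"
      by (rule prod_sum_PiE) (use J in auto)
    also have "\<dots> = (\<Sum>k \<in> PiE J (\<lambda>_. {..D}). Const (b k) * (\<Prod>i\<in>J. bernstein_poly N D (k i) i))"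
      by (simp add: prod.distrib Const_prod b_def)
    finally have expansion: "(\<Prod>i\<in>J. upper_factor N i ^ a i) =
      (\<Sum>k \<in> PiE J (\<lambda>_. {..D}). Const (b k) * (\<Prod>i\<in>J. bernstein_poly N D (k i) i))" .
    have "\<bar>b k - peval (\<Prod>i\<in>J. upper_factor N i ^ a i) (grid_point N D k)\<bar> \<le> \<epsilon>"
      if "k \<in> PiE J (\<lambda>_. {..D})" for k
    proof -
      have k: "k i \<le> D" if "i \<in> J" for i
        using \<open>k \<in> _\<close> that by auto
      have "peval (upper_factor N i) (grid_point N D k) = real (k i) / real D" for i
        using N D by (simp add: upper_factor_def peval_hom grid_point_def)
      then have ev: "peval (\<Prod>i\<in>J. upper_factor N i ^ a i) (grid_point N D k) = (\<Prod>i\<in>J. (real (k i) / real D) ^ a i)"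
        by (simp add: peval_hom)
      have "\<bar>b k - (\<Prod>i\<in>J. (real (k i) / real D) ^ a i)\<bar>
          \<le> (\<Sum>i\<in>J. \<bar>r i (k i) - (real (k i) / real D) ^ a i\<bar>)"
        using norm_prod_diff[of J "\<lambda>i. r i (k i)" "\<lambda>i. (real (k i) / real D) ^ a i"] k D
        by (simp add: b_def r_def binomial_ratio_le_1 power_le_one)
      also have "\<dots> \<le> (\<Sum>i\<in>J. (real m)\<^sup>2 / (real D - real m))"
      proof (rule sum_mono)
        fix i assume i: "i \<in> J"
        have "\<bar>r i (k i) - (real (k i) / real D) ^ a i\<bar> \<le> (real (a i))\<^sup>2 / (real D - real (a i))"
          unfolding r_def using am[OF i] k[OF i] D by (intro binomial_ratio_approx) auto
        also have "\<dots> \<le> (real m)\<^sup>2 / (real D - real m)"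
          using am[OF i] D by (intro frac_le power_mono) auto
        finally show "\<bar>r i (k i) - (real (k i) / real D) ^ a i\<bar> \<le> (real m)\<^sup>2 / (real D - real m)" .
      qed
      also have "\<dots> = w / (real D - real m)"
        by (simp add: w_def)
      also have "\<dots> \<le> \<epsilon>"
      proof -
        have "w < \<epsilon> * real q"
          using q \<epsilon> by (simp add: pos_divide_less_eq mult.commute)
        also have "\<epsilon> * real q \<le> \<epsilon> * (real D - real m)"
          using D \<epsilon> by (intro mult_left_mono) auto
        finally show ?thesis
          using D by (simp add: pos_divide_le_eq)
      qed
      finally show ?thesis
        by (simp add: ev)
    qed
    with expansion show "\<exists>b. bernstein_expansion N J D \<epsilon> (\<Prod>i\<in>J. upper_factor N i ^ a i) b"
      unfolding bernstein_expansion_def by blast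
  qed
qed

lemma bernstein_approximable_add:
  assumes "bernstein_approximable N J f" "bernstein_approximable N J g"
  shows "bernstein_approximable N J (f + g)"
  unfolding bernstein_approximable_def
proof (intro allI impI)
  fix \<epsilon> :: real assume "\<epsilon> > 0"
  then have "\<epsilon> / 2 > 0" by simp
  then obtain D1 D2 where
    D1: "\<forall>D\<ge>D1. \<exists>b. bernstein_expansion N J D (\<epsilon> / 2) f b" and
    D2: "\<forall>D\<ge>D2. \<exists>b. bernstein_expansion N J D (\<epsilon> / 2) g b"
    using assms unfolding bernstein_approximable_def by blast
  show "\<exists>D0. \<forall>D\<ge>D0. \<exists>b. bernstein_expansion N J D \<epsilon> (f + g) b"
  proof (rule exI[of _ "max D1 D2"], intro allI impI)
    fix D assume "max D1 D2 \<le> D"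
    then obtain b1 b2 where
      b1: "f = (\<Sum>k \<in> PiE J (\<lambda>_. {..D}). Const (b1 k) * (\<Prod>i\<in>J. bernstein_poly N D (k i) i))"
        "\<And>k. k \<in> PiE J (\<lambda>_. {..D}) \<Longrightarrow> \<bar>b1 k - peval f (grid_point N D k)\<bar> \<le> \<epsilon> / 2" and
      b2: "g = (\<Sum>k \<in> PiE J (\<lambda>_. {..D}). Const (b2 k) * (\<Prod>i\<in>J. bernstein_poly N D (k i) i))"
        "\<And>k. k \<in> PiE J (\<lambda>_. {..D}) \<Longrightarrow> \<bar>b2 k - peval g (grid_point N D k)\<bar> \<le> \<epsilon> / 2"
      using D1[rule_format, of D] D2[rule_format, of D] by (auto simp: bernstein_expansion_def)
    have "f + g = (\<Sum>k \<in> PiE J (\<lambda>_. {..D}). Const (b1 k + b2 k) * (\<Prod>i\<in>J. bernstein_poly N D (k i) i))"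
      by (subst b1(1), subst b2(1)) (simp add: Const_add distrib_right sum.distrib)
    moreover have "\<bar>(b1 k + b2 k) - peval (f + g) (grid_point N D k)\<bar> \<le> \<epsilon>"
      if "k \<in> PiE J (\<lambda>_. {..D})" for k
      using b1(2)[OF that] b2(2)[OF that] unfolding peval_hom by linarith
    ultimately show "\<exists>b. bernstein_expansion N J D \<epsilon> (f + g) b"
      by (intro exI[of _ "\<lambda>k. b1 k + b2 k"]) (simp only: bernstein_expansion_def, blast)
  qed
qed

lemma bernstein_approximable_scale:
  assumes "bernstein_approximable N J f"
  shows "bernstein_approximable N J (Const r * f)"
  unfolding bernstein_approximable_def
proof (intro allI impI)
  fix \<epsilon> :: real assume \<epsilon>: "\<epsilon> > 0"
  \<comment> \<open>The summand 1 covers the case \<open>r = 0\<close>.\<close>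
  then have "\<epsilon> / (\<bar>r\<bar> + 1) > 0" by simp
  then obtain D0 where
    D0: "\<forall>D\<ge>D0. \<exists>b. bernstein_expansion N J D (\<epsilon> / (\<bar>r\<bar> + 1)) f b"
    using assms unfolding bernstein_approximable_def by blast
  show "\<exists>D0. \<forall>D\<ge>D0. \<exists>b. bernstein_expansion N J D \<epsilon> (Const r * f) b"
  proof (rule exI[of _ D0], intro allI impI)
    fix D assume "D0 \<le> D"
    then obtain b where
      b: "f = (\<Sum>k \<in> PiE J (\<lambda>_. {..D}). Const (b k) * (\<Prod>i\<in>J. bernstein_poly N D (k i) i))"
        "\<And>k. k \<in> PiE J (\<lambda>_. {..D}) \<Longrightarrow> \<bar>b k - peval f (grid_point N D k)\<bar> \<le> \<epsilon> / (\<bar>r\<bar> + 1)"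
      using D0[rule_format, of D] by (auto simp: bernstein_expansion_def)
    have "Const r * f = (\<Sum>k \<in> PiE J (\<lambda>_. {..D}). Const (r * b k) * (\<Prod>i\<in>J. bernstein_poly N D (k i) i))"
      by (subst b(1)) (simp add: Const_mult sum_distrib_left mult.assoc)
    moreover have "\<bar>r * b k - peval (Const r * f) (grid_point N D k)\<bar> \<le> \<epsilon>"
      if "k \<in> PiE J (\<lambda>_. {..D})" for k
    proof -
      have "\<bar>r * b k - peval (Const r * f) (grid_point N D k)\<bar> = \<bar>r\<bar> * \<bar>b k - peval f (grid_point N D k)\<bar>"
        by (simp add: peval_hom abs_mult[symmetric] algebra_simps)
      also have "\<dots> \<le> (\<bar>r\<bar> + 1) * (\<epsilon> / (\<bar>r\<bar> + 1))"
        using b(2)[OF that] by (intro mult_mono) auto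
      also have "\<dots> = \<epsilon>"
        by (smt (verit) nonzero_mult_div_cancel_left times_divide_eq_right)
      finally show ?thesis .
    qed
    ultimately show "\<exists>b. bernstein_expansion N J D \<epsilon> (Const r * f) b"
      by (intro exI[of _ "\<lambda>k. r * b k"]) (simp only: bernstein_expansion_def, blast)
  qed
qed

text \<open>
  The approximable polynomials form a vector space containing all monomials in the upper factors.
  These monomials span the polynomials in \<open>J\<close>, as each variable is an affine function of its upper
  factor; carrying an arbitrary monomial through the induction makes multiplication by a variable
  a step inside that space.
\<close>

lemma bernstein_approximable_poly:
  assumes N: "N > 0" and J: "finite J" and f: "f \<in> polys_in J"
  shows "bernstein_approximable N J f"
proof -
  have "bernstein_approximable N J (f * (\<Prod>i\<in>J. upper_factor N i ^ a i))" for a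
    using f
  proof (induction f arbitrary: a rule: polys_in_induct)
    case (Const r)
    show ?case
      by (intro bernstein_approximable_scale bernstein_approximable_monomial N J)
  next
    case (add p q)
    then show ?case
      by (simp add: distrib_right bernstein_approximable_add)
  next
    case (mult p i)
    let ?m = "\<lambda>a. \<Prod>i\<in>J. upper_factor N i ^ a i"
    have "(\<Prod>j\<in>J - {i}. upper_factor N j ^ (a(i := Suc (a i))) j) = (\<Prod>j\<in>J - {i}. upper_factor N j ^ a j)"
      by (rule prod.cong) auto
    then have "?m (a(i := Suc (a i))) = upper_factor N i * ?m a"
      using J mult.hyps by (simp add: prod.remove mult_ac)
    then have "p * Var i * ?m a = Const (2 * N) * (p * ?m (a(i := Suc (a i)))) + Const (- N) * (p * ?m a)"
      by (simp add: Var_eq_upper_factor[OF N, of i] Const_uminus algebra_simps)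
    then show ?case
      by (simp only:) (intro bernstein_approximable_add bernstein_approximable_scale mult.IH)
  qed
  from this[of "\<lambda>_. 0"] show ?thesis by simp
qed

text \<open>
  Choose a degree for which the Bernstein coefficients of \<open>f\<close> differ from its values on the grid
  by no more than a positive lower bound \<open>\<delta>\<close> of \<open>f\<close> on the box. All coefficients are then nonnegative, and \<open>f\<close> is a
  nonnegative combination of products of the generators \<open>N \<plusminus> x\<^sub>i\<close>.
\<close>

proposition positive_on_box_in_semiring:
  assumes N: "N > 0" and J: "finite J" and f: "f \<in> polys_in J"
    and T: "nonneg_semiring T"
    and up: "\<And>i. i \<in> J \<Longrightarrow> Const N + Var i \<in> T" and down: "\<And>i. i \<in> J \<Longrightarrow> Const N - Var i \<in> T"
    and pos: "\<And>x. (\<And>i. i \<in> J \<Longrightarrow> \<bar>x i\<bar> \<le> N) \<Longrightarrow> 0 < peval f x"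
  shows "f \<in> T"
proof -
  note T_closed = nonneg_semiring_closed[OF T]
  let ?box = "{x :: nat \<Rightarrow> real. \<forall>i. if i \<in> J then \<bar>x i\<bar> \<le> N else x i = 0}"
  have "\<exists>\<delta>>0. \<forall>x\<in>?box. \<delta> \<le> peval f x"
  proof (rule compact_pos_bounded_below[OF compact_coordinate_box continuous_on_peval])
    show "0 < peval f x" if "x \<in> ?box" for x
    proof (rule pos)
      show "\<bar>x i\<bar> \<le> N" if "i \<in> J" for i
        using \<open>x \<in> ?box\<close> that by (auto dest: spec[of _ i])
    qed
  qed
  then obtain \<delta> where \<delta>: "\<delta> > 0" "\<And>x. x \<in> ?box \<Longrightarrow> \<delta> \<le> peval f x"
    by blast
  obtain D0 where
    D0: "\<forall>D\<ge>D0. \<exists>b. bernstein_expansion N J D \<delta> f b"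
    using bernstein_approximable_poly[OF N J f] \<delta>(1) unfolding bernstein_approximable_def by blast
  \<comment> \<open>The successor keeps the denominator \<open>D\<close> of the grid nonzero.\<close>
  define D where "D = Suc D0"
  obtain b where b: "f = (\<Sum>k \<in> PiE J (\<lambda>_. {..D}). Const (b k) * (\<Prod>i\<in>J. bernstein_poly N D (k i) i))"
      "\<And>k. k \<in> PiE J (\<lambda>_. {..D}) \<Longrightarrow> \<bar>b k - peval f (grid_point N D k)\<bar> \<le> \<delta>"
    using D0[rule_format, of D] by (auto simp: D_def bernstein_expansion_def)
  have b_nonneg: "b k \<ge> 0" if k: "k \<in> PiE J (\<lambda>_. {..D})" for k
  proof -
    define x where "x = (\<lambda>i. if i \<in> J then grid_point N D k i else 0)"
    have "\<bar>grid_point N D k i\<bar> \<le> N" if "i \<in> J" for i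
    proof -
      have "real (k i) / real D \<in> {0..1}"
        using PiE_mem[OF k that] by (auto simp: D_def divide_simps)
      then have "0 \<le> N * (real (k i) / real D)" "N * (real (k i) / real D) \<le> N"
        using N mult_left_mono[of "real (k i) / real D" 1 N] by auto
      then show ?thesis
        unfolding grid_point_def by linarith
    qed
    then have "x \<in> ?box"
      by (simp add: x_def)
    moreover have "peval f x = peval f (grid_point N D k)"
      by (rule peval_cong[OF f]) (simp add: x_def)
    ultimately show ?thesis
      using \<delta>(2)[of x] b(2)[OF k] by linarith
  qed
  have half: "Const (1 / (2 * N)) \<in> T"
    using N by (intro T_closed) simp
  show ?thesis
    by (subst b(1))
      (auto intro!: T_closed b_nonneg half up down simp: bernstein_poly_def upper_factor_def lower_factor_def)
qed

section \<open>Positivity on a ball\<close>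

text \<open>
  The polynomials that a block may contribute to the representation, before the sums of monomial
  squares are relaxed to an arbitrary class.
\<close>

definition ball_cone :: "nat set \<Rightarrow> real \<Rightarrow> mpoly set" where
  "ball_cone J r = {psubst a (ball_args J r) + psubst b (ball_args J r) * ball_poly J r | a b.
     a \<in> SOMS (2 * card J + 1) \<and> b \<in> SOMS (2 * card J + 1)}"

lemma ball_coneI:
  "a \<in> SOMS (2 * card J + 1) \<Longrightarrow> b \<in> SOMS (2 * card J + 1) \<Longrightarrow>
   f = psubst a (ball_args J r) + psubst b (ball_args J r) * ball_poly J r \<Longrightarrow> f \<in> ball_cone J r"
  unfolding ball_cone_def by blast

lemma length_ball_args: "length (ball_args J r) = 2 * card J + 1"
  by (simp add: ball_args_def)

lemma square_of_arg_in_ball_cone: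
  assumes "q \<in> set (ball_args J r)"
  shows "q\<^sup>2 \<in> ball_cone J r"
proof -
  obtain t where t: "t < 2 * card J + 1" "ball_args J r ! t = q"
    using assms by (auto simp: in_set_conv_nth length_ball_args)
  then have "psubst ((Var (Suc t))\<^sup>2) (ball_args J r) = q\<^sup>2"
    by (simp add: psubst_hom)
  moreover have "(Var (Suc t))\<^sup>2 \<in> SOMS (2 * card J + 1)"
    using t(1) by (intro SOMS_Var_square) auto
  ultimately show ?thesis
    by (intro ball_coneI[OF _ SOMS_0]) (auto simp: psubst_hom)
qed

text \<open>
  A product contributes a term with \<open>u\<^sup>2\<close>. Since \<open>u\<close> is itself the last substituted argument,
  \<open>u\<^sup>2\<close> is the value of a monomial square and can be absorbed into the first summand.
\<close>

lemma nonneg_semiring_ball_cone: "nonneg_semiring (ball_cone J r)"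
  unfolding nonneg_semiring_def
proof (intro conjI allI impI ballI)
  let ?s = "2 * card J + 1" and ?ev = "\<lambda>a. psubst a (ball_args J r)" and ?u = "ball_poly J r"
  note soms = nonneg_semiring_closed[OF nonneg_semiring_SOMS]
  show "Const t \<in> ball_cone J r" if "t \<ge> 0" for t
    by (rule ball_coneI[OF soms(1)[OF that] SOMS_0]) (simp add: psubst_hom)
  fix p q assume "p \<in> ball_cone J r" "q \<in> ball_cone J r"
  then obtain a b a' b' where
    S: "a \<in> SOMS ?s" "b \<in> SOMS ?s" "a' \<in> SOMS ?s" "b' \<in> SOMS ?s" and
    p: "p = ?ev a + ?ev b * ?u" and q: "q = ?ev a' + ?ev b' * ?u"
    unfolding ball_cone_def by blast
  show "p + q \<in> ball_cone J r"
    by (rule ball_coneI[of "a + a'" _ "b + b'"]) (use S in \<open>auto intro!: soms simp: p q psubst_hom algebra_simps\<close>)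
  define w where "w = (Var ?s)\<^sup>2"
  have w: "w \<in> SOMS ?s"
    unfolding w_def by (rule SOMS_Var_square) auto
  have "ball_args J r ! (2 * card J) = ?u"
    by (simp add: ball_args_def nth_append)
  then have ev_w: "?ev w = ?u\<^sup>2"
    by (simp add: w_def psubst_hom)
  show "p * q \<in> ball_cone J r"
    by (rule ball_coneI[of "a * a' + b * b' * w" _ "a * b' + b * a'"])
      (use S w in \<open>auto intro!: soms simp: p q ev_w psubst_hom power2_eq_square algebra_simps\<close>)
qed

lemma ball_poly_in_ball_cone: "ball_poly J r \<in> ball_cone J r"
  by (rule ball_coneI[OF SOMS_0 nonneg_semiring_closed(1)[OF nonneg_semiring_SOMS, of 1]])
    (simp_all add: psubst_hom)

lemma
  assumes "finite J" "i \<in> J"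
  shows shifted_square_in_ball_cone: "(Var i + Const r)\<^sup>2 \<in> ball_cone J r" "(Const r - Var i)\<^sup>2 \<in> ball_cone J r"
    and square_plus_in_ball_cone: "(Var i)\<^sup>2 + (Const r)\<^sup>2 \<in> ball_cone J r"
proof -
  show 1: "(Var i + Const r)\<^sup>2 \<in> ball_cone J r" "(Const r - Var i)\<^sup>2 \<in> ball_cone J r"
    using assms by (auto intro!: square_of_arg_in_ball_cone simp: ball_args_def)
  have half: "Const (1 / 2) * 2 = 1"
    unfolding Const_numeral[symmetric] by (simp flip: Const_mult)
  \<comment> \<open>The mixed terms cancel in the mean of the two squares.\<close>
  have "Const (1 / 2) * ((Var i + Const r)\<^sup>2 + (Const r - Var i)\<^sup>2) = Const (1 / 2) * 2 * ((Var i)\<^sup>2 + (Const r)\<^sup>2)"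
    by (simp add: power2_eq_square algebra_simps)
  then have "Const (1 / 2) * ((Var i + Const r)\<^sup>2 + (Const r - Var i)\<^sup>2) = (Var i)\<^sup>2 + (Const r)\<^sup>2"
    by (simp add: half)
  moreover have "Const (1 / 2) * ((Var i + Const r)\<^sup>2 + (Const r - Var i)\<^sup>2) \<in> ball_cone J r"
    by (intro nonneg_semiring_closed[OF nonneg_semiring_ball_cone] 1) simp
  ultimately show "(Var i)\<^sup>2 + (Const r)\<^sup>2 \<in> ball_cone J r"
    by simp
qed

text \<open>
  The quadratic terms of \<open>(x\<^sub>i + r)\<^sup>2\<close> are cancelled by \<open>u\<close>, and those of \<open>u\<close> in the other variables
  by the elements \<open>x\<^sub>j\<^sup>2 + r\<^sup>2\<close>; what is left is affine in \<open>x\<^sub>i\<close>.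
\<close>

lemma bounded_coordinates_in_ball_cone:
  assumes J: "finite J" and i: "i \<in> J" and r: "r > 0" and N: "N = (real (card J) + 1) * r / 2"
  shows "Const N + Var i \<in> ball_cone J r" "Const N - Var i \<in> ball_cone J r"
proof -
  note closed = nonneg_semiring_closed[OF nonneg_semiring_ball_cone]
  \<comment> \<open>Together with \<open>(x\<^sub>i + r)\<^sup>2\<close> this cancels all squares of variables in \<open>u\<close>.\<close>
  define Q where "Q = (\<Sum>j \<in> J - {i}. (Var j)\<^sup>2 + (Const r)\<^sup>2)"
  have Q: "Q \<in> ball_cone J r"
    unfolding Q_def using J by (intro closed square_plus_in_ball_cone) auto
  have "Q + ((Var i)\<^sup>2 + (Const r)\<^sup>2) = (\<Sum>j\<in>J. (Var j)\<^sup>2 + (Const r)\<^sup>2)"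
    using J i by (simp add: Q_def sum.remove add_ac)
  also have "\<dots> = (\<Sum>j\<in>J. (Var j)\<^sup>2) + of_nat (card J) * (Const r)\<^sup>2"
    by (simp add: sum.distrib)
  finally have ballQ: "ball_poly J r + Q = of_nat (card J) * (Const r)\<^sup>2 - (Var i)\<^sup>2"
    by (simp add: ball_poly_def Const_power algebra_simps)
  have "2 * r * N = (real (card J) + 1) * r\<^sup>2"
    by (simp add: N power2_eq_square)
  then have "Const (2 * r) * Const N = (of_nat (card J) + 1) * (Const r)\<^sup>2"
    by (metis Const_1 Const_add Const_mult Const_of_nat Const_power)
  then have 1: "Const (2 * r) * (Const N + Var i) = (Var i + Const r)\<^sup>2 + (ball_poly J r + Q)"
    and 2: "Const (2 * r) * (Const N - Var i) = (Const r - Var i)\<^sup>2 + (ball_poly J r + Q)"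
    unfolding ballQ by (simp_all add: Const_mult Const_numeral power2_eq_square algebra_simps)
  have cancel: "Const (1 / (2 * r)) * (Const (2 * r) * q) = q" for q
    using r by (simp add: mult.assoc[symmetric] flip: Const_mult)
  have "Const (1 / (2 * r)) * (Const (2 * r) * (Const N + Var i)) \<in> ball_cone J r"
    unfolding 1 using J i r
    by (intro closed shifted_square_in_ball_cone ball_poly_in_ball_cone Q) auto
  then show "Const N + Var i \<in> ball_cone J r"
    by (simp only: cancel)
  have "Const (1 / (2 * r)) * (Const (2 * r) * (Const N - Var i)) \<in> ball_cone J r"
    unfolding 2 using J i r
    by (intro closed shifted_square_in_ball_cone ball_poly_in_ball_cone Q) auto
  then show "Const N - Var i \<in> ball_cone J r"
    by (simp only: cancel)
qed

lemma peval_ball_poly: "peval (ball_poly J r) x = r\<^sup>2 - (\<Sum>i\<in>J. (x i)\<^sup>2)"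
  by (simp add: ball_poly_def peval_hom)

lemma ball_poly_in_polys: "ball_poly J r \<in> polys_in J"
  unfolding ball_poly_def by (intro polys_in_diff polys_in_sum polys_in_power polys_in_Const polys_in_Var)

text \<open>
  Membership of \<open>N \<plusminus> x\<^sub>i\<close> settles positivity on the box \<open>[-N, N]\<^sup>d\<close> only, which extends beyond the
  ball. A penalty \<open>\<sigma>\<close> with the constraint \<open>u \<ge> 0\<close> makes \<open>f - \<sigma>\<close> positive on the box. It is a
  power of \<open>V - u\<close> times \<open>u\<close> up to a positive factor, so the bound \<open>V\<close> is taken so large that \<open>V - u = \<Sum>\<^sub>j (x\<^sub>j\<^sup>2 + r\<^sup>2)\<close> belongs to the
  cone; hence \<open>\<sigma>\<close> does too.
\<close>

proposition positive_on_ball_in_ball_cone: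
  assumes J: "finite J" and r: "r > 0" and f: "f \<in> polys_in J"
    and pos: "\<And>x. L2_set x J \<le> r \<Longrightarrow> 0 < peval f x"
  shows "f \<in> ball_cone J r"
proof -
  note closed = nonneg_semiring_closed[OF nonneg_semiring_ball_cone]
  define N where "N = (real (card J) + 1) * r / 2"
  define V where "V = (real (card J) + 1) * r\<^sup>2"
  have "N > 0" "V > 0"
    using r by (auto simp: N_def V_def intro!: mult_pos_pos)
  let ?u = "ball_poly J r"
  let ?box = "{x :: nat \<Rightarrow> real. \<forall>i. if i \<in> J then \<bar>x i\<bar> \<le> N else x i = 0}"
  have u_le: "peval ?u x \<le> V" for x
  proof -
    have "peval ?u x \<le> r\<^sup>2"
      by (simp add: peval_ball_poly sum_nonneg)
    also have "\<dots> \<le> V"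
      by (simp add: V_def algebra_simps)
    finally show ?thesis .
  qed
  have "\<exists>c\<ge>0. \<exists>M. \<forall>x\<in>?box. 0 < peval f x - (\<Sum>j\<in>{()}. c * (1 - peval ?u x / V) ^ (2 * M) * peval ?u x)"
  proof (rule compact_even_power_penalty)
    show "0 < peval f x" if "x \<in> ?box" "\<And>j. j \<in> {()} \<Longrightarrow> 0 \<le> peval ?u x" for x
    proof (rule pos)
      show "L2_set x J \<le> r"
        unfolding L2_set_def using that(2) r by (intro real_le_lsqrt) (auto simp: peval_ball_poly)
    qed
    show "peval ?u x \<le> V" for x by (rule u_le)
  qed (simp_all only: \<open>V > 0\<close> compact_coordinate_box continuous_on_peval finite.intros)
  then obtain c M where c: "c \<ge> 0" and
    pen: "\<And>x. x \<in> ?box \<Longrightarrow> 0 < peval f x - c * (1 - peval ?u x / V) ^ (2 * M) * peval ?u x"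
    by auto
  define \<sigma> where "\<sigma> = Const c * (Const (1 / V) * (Const V - ?u)) ^ (2 * M) * ?u"
  have ev_\<sigma>: "peval \<sigma> x = c * (1 - peval ?u x / V) ^ (2 * M) * peval ?u x" for x
    using \<open>V > 0\<close> by (simp add: \<sigma>_def peval_hom diff_divide_distrib)
  have \<sigma>_polys: "\<sigma> \<in> polys_in J"
    unfolding \<sigma>_def by (intro polys_in_mult polys_in_power polys_in_diff polys_in_Const ball_poly_in_polys)
  have "Const V - ?u = (\<Sum>j\<in>J. (Var j)\<^sup>2 + (Const r)\<^sup>2)"
    by (simp add: V_def ball_poly_def sum.distrib Const_hom Const_of_nat algebra_simps)
  also have "\<dots> \<in> ball_cone J r"
    by (intro closed square_plus_in_ball_cone J)
  finally have "\<sigma> \<in> ball_cone J r"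
    unfolding \<sigma>_def using c \<open>V > 0\<close> by (intro closed ball_poly_in_ball_cone) auto
  moreover have "f - \<sigma> \<in> ball_cone J r"
  proof (rule positive_on_box_in_semiring[OF \<open>N > 0\<close> J])
    show "f - \<sigma> \<in> polys_in J"
      using f \<sigma>_polys by blast
    show "0 < peval (f - \<sigma>) x" if x: "\<And>i. i \<in> J \<Longrightarrow> \<bar>x i\<bar> \<le> N" for x
    proof -
      define y where "y = (\<lambda>i. if i \<in> J then x i else 0)"
      have "0 < peval (f - \<sigma>) y"
        using pen[of y] x by (simp add: y_def peval_hom ev_\<sigma>)
      also have "peval (f - \<sigma>) y = peval (f - \<sigma>) x"
        by (rule peval_cong[of _ J]) (use f \<sigma>_polys in \<open>auto simp: y_def\<close>)
      finally show ?thesis .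
    qed
  qed (use bounded_coordinates_in_ball_cone[OF J _ r N_def] nonneg_semiring_ball_cone in auto)
  ultimately have "\<sigma> + (f - \<sigma>) \<in> ball_cone J r"
    by (rule closed)
  then show ?thesis by simp
qed

section \<open>Splitting a positive sparse polynomial\<close>

text \<open>
  Vectors live in the infinite product \<open>nat \<Rightarrow> real\<close>. Setting the irrelevant entries to zero keeps the
  sets under consideration compact and lets the variables in \<open>W\<close> separate points.
\<close>

definition zero_outside :: "nat set \<Rightarrow> (nat \<Rightarrow> real) \<Rightarrow> nat \<Rightarrow> real" where
  "zero_outside W x = (\<lambda>i. if i \<in> W then x i else 0)"

lemma zero_outside_eq_0: "i \<notin> W \<Longrightarrow> zero_outside W x i = 0"
  by (simp add: zero_outside_def)

lemma peval_zero_outside: "p \<in> polys_in J \<Longrightarrow> J \<subseteq> W \<Longrightarrow> peval p (zero_outside W x) = peval p x"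
  by (rule peval_cong) (auto simp: zero_outside_def)

lemma L2_set_zero_outside: "J \<subseteq> W \<Longrightarrow> L2_set (zero_outside W x) J = L2_set x J"
  unfolding L2_set_def zero_outside_def by (intro arg_cong[where f = sqrt] sum.cong) auto

lemma abs_coordinate_le_L2_set: "finite J \<Longrightarrow> i \<in> J \<Longrightarrow> \<bar>x i\<bar> \<le> L2_set x J"
  using member_le_L2_set[of J i "\<lambda>i. \<bar>x i\<bar>"] by (simp add: L2_set_def)

lemma compact_sparse_ball:
  fixes F :: "'l \<Rightarrow> nat set"
  assumes fin: "finite \<Lambda>" "\<And>l. l \<in> \<Lambda> \<Longrightarrow> finite (F l)" and V: "V = (\<Union>l\<in>\<Lambda>. F l)"
  shows "compact {x. (\<forall>i. i \<notin> V \<longrightarrow> x i = 0) \<and> (\<forall>l\<in>\<Lambda>. L2_set x (F l) \<le> R l)}"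
proof -
  define M where "M = (\<Sum>l\<in>\<Lambda>. \<bar>R l\<bar>)"
  let ?box = "{x :: nat \<Rightarrow> real. \<forall>i. if i \<in> V then \<bar>x i\<bar> \<le> M else x i = 0}"
  have "continuous_on UNIV (\<lambda>x. L2_set x (F l))" for l
    unfolding L2_set_def
    by (intro continuous_on_real_sqrt continuous_on_sum continuous_on_power continuous_on_coordinate)
  then have "closed {x. L2_set x (F l) \<le> R l}" for l
    by (intro closed_Collect_le) auto
  then have "closed (\<Inter>l\<in>\<Lambda>. {x. L2_set x (F l) \<le> R l})"
    by blast
  then have "compact (?box \<inter> (\<Inter>l\<in>\<Lambda>. {x. L2_set x (F l) \<le> R l}))"
    by (rule compact_Int_closed[OF compact_coordinate_box])
  also have "?box \<inter> (\<Inter>l\<in>\<Lambda>. {x. L2_set x (F l) \<le> R l})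
      = {x. (\<forall>i. i \<notin> V \<longrightarrow> x i = 0) \<and> (\<forall>l\<in>\<Lambda>. L2_set x (F l) \<le> R l)}" (is "?A = ?B")
  proof
    show "?B \<subseteq> ?A"
    proof
      fix x assume x: "x \<in> ?B"
      have "\<bar>x i\<bar> \<le> M" if "i \<in> V" for i
      proof -
        obtain l where l: "l \<in> \<Lambda>" "i \<in> F l"
          using \<open>i \<in> V\<close> V by blast
        have "\<bar>x i\<bar> \<le> L2_set x (F l)"
          using fin(2) l by (intro abs_coordinate_le_L2_set) auto
        also have "\<dots> \<le> \<bar>R l\<bar>"
          using x l by fastforce
        also have "\<dots> \<le> M"
          unfolding M_def using fin(1) l by (intro member_le_sum) auto
        finally show ?thesis .
      qed
      with x show "x \<in> ?A" by auto
    qed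
  qed (auto split: if_splits)
  finally show ?thesis .
qed

text \<open>
  A polynomial in the variables \<open>W\<close> that lies below \<open>f\<close> on \<open>A\<close> and above \<open>- g\<close> on \<open>B\<close>. The lower
  envelope of \<open>f\<close> along the fibres of the projection to \<open>W\<close> need not be continuous and is defined
  only over the projection of \<open>A\<close>. Its Lipschitz regularisation
  \<open>\<phi>(w) = inf\<^sub>x\<^sub>\<in>\<^sub>A (f(x) + \<mu> |x\<^sub>W - w\<^sub>W|)\<close> is defined and continuous everywhere, still at most \<open>f\<close> on
  \<open>A\<close>, and for large \<open>\<mu>\<close> still exceeds \<open>- g\<close> on \<open>B\<close> by a fixed margin: the latter is
  \<open>compact_linear_penalty\<close> on \<open>A \<times> B\<close>. The Stone-Weierstrass theorem then gives the polynomial.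
\<close>

lemma separating_polynomial:
  fixes A B :: "(nat \<Rightarrow> real) set" and f g :: "(nat \<Rightarrow> real) \<Rightarrow> real"
  assumes A: "compact A" and B: "compact B"
    and f: "continuous_on A f" and g: "continuous_on B g"
    and pos: "\<And>x y. x \<in> A \<Longrightarrow> y \<in> B \<Longrightarrow> (\<And>i. i \<in> W \<Longrightarrow> x i = y i) \<Longrightarrow> 0 < f x + g y"
    and W: "finite W"
  shows "\<exists>h \<in> polys_in W. (\<forall>x\<in>A. peval h x < f x) \<and> (\<forall>y\<in>B. - g y < peval h y)"
\<comment> \<open>The infimum over \<open>A\<close> below is meaningful only if \<open>A\<close> is nonempty.\<close>
proof (cases "A = {}")
  case True
  obtain M where M: "\<And>y. y \<in> B \<Longrightarrow> \<bar>g y\<bar> \<le> M"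
    using compact_imp_bounded[OF compact_continuous_image[OF g B]] by (auto simp: bounded_iff)
  have "- g y < M + 1" if "y \<in> B" for y
    using M[OF that] by linarith
  with True show ?thesis
    by (intro bexI[of _ "Const (M + 1)"]) (simp_all add: peval_hom)
next
  case False
  define d where "d = (\<lambda>x y. \<Sum>i\<in>W. \<bar>x i - y i :: real\<bar>)"
  have d_nonneg: "0 \<le> d x y" and d_self: "d x x = 0" for x y
    by (auto simp: d_def sum_nonneg)
  have d_triangle: "d x y \<le> d x z + d z y" for x y z
    unfolding d_def sum.distrib[symmetric] by (rule sum_mono) linarith
  have d_commute: "d x y = d y x" for x y
    by (simp add: d_def abs_minus_commute)
  have d_zero: "x i = y i" if "d x y = 0" "i \<in> W" for x y i
    using that W unfolding d_def by (subst (asm) sum_nonneg_eq_0_iff) auto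
  have coord: "continuous_on S (\<lambda>z. fst z i :: real)" "continuous_on S (\<lambda>z. snd z i :: real)"
    for S :: "((nat \<Rightarrow> real) \<times> (nat \<Rightarrow> real)) set" and i
    by (rule continuous_on_compose2[OF continuous_on_coordinate[of UNIV] continuous_on_fst[OF continuous_on_id]], simp)
      (rule continuous_on_compose2[OF continuous_on_coordinate[of UNIV] continuous_on_snd[OF continuous_on_id]], simp)
  have cont_f: "continuous_on (A \<times> B) (\<lambda>z. f (fst z))"
    by (rule continuous_on_compose2[OF f continuous_on_fst[OF continuous_on_id]]) auto
  have cont_g: "continuous_on (A \<times> B) (\<lambda>z. g (snd z))"
    by (rule continuous_on_compose2[OF g continuous_on_snd[OF continuous_on_id]]) auto
  have "\<exists>\<mu>\<ge>0. \<exists>\<delta>>0. \<forall>z \<in> A \<times> B. \<delta> \<le> (f (fst z) + g (snd z)) + \<mu> * d (fst z) (snd z)"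
  proof (rule compact_linear_penalty)
    show "compact (A \<times> B)"
      using A B by (rule compact_Times)
    show "continuous_on (A \<times> B) (\<lambda>z. f (fst z) + g (snd z))"
      using cont_f cont_g by (rule continuous_on_add)
    show "continuous_on (A \<times> B) (\<lambda>z. d (fst z) (snd z))"
      unfolding d_def
      by (intro continuous_on_sum continuous_on_rabs continuous_on_diff coord)
    show "0 < f (fst z) + g (snd z)" if "z \<in> A \<times> B" "d (fst z) (snd z) = 0" for z
      using pos[of "fst z" "snd z"] d_zero[OF that(2)] that(1) by (simp add: mem_Times_iff)
  qed (rule d_nonneg)
  then obtain \<mu> \<delta> where \<mu>: "\<mu> \<ge> 0" and \<delta>: "\<delta> > 0"
    and pen: "\<And>z. z \<in> A \<times> B \<Longrightarrow> \<delta> \<le> (f (fst z) + g (snd z)) + \<mu> * d (fst z) (snd z)"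
    by blast
  obtain M where M: "\<And>x. x \<in> A \<Longrightarrow> \<bar>f x\<bar> \<le> M"
    using compact_imp_bounded[OF compact_continuous_image[OF f A]] by (auto simp: bounded_iff)
  define \<phi> where "\<phi> = (\<lambda>w. INF x\<in>A. f x + \<mu> * d x w)"
  have bdd: "bdd_below ((\<lambda>x. f x + \<mu> * d x w) ` A)" for w
  proof (rule bdd_belowI2)
    fix x assume "x \<in> A"
    then show "- M \<le> f x + \<mu> * d x w"
      using M[of x] mult_nonneg_nonneg[OF \<mu> d_nonneg[of x w]] by linarith
  qed
  have \<phi>_lower: "\<phi> w \<le> f x + \<mu> * d x w" if "x \<in> A" for x w
    unfolding \<phi>_def using bdd that by (rule cINF_lower)
  have \<phi>_A: "\<phi> x \<le> f x" if "x \<in> A" for x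
    using \<phi>_lower[OF that, of x] by (simp add: d_self)
  have \<phi>_B: "\<delta> - g y \<le> \<phi> y" if "y \<in> B" for y
    unfolding \<phi>_def
  proof (rule cINF_greatest[OF False])
    fix x assume "x \<in> A"
    then show "\<delta> - g y \<le> f x + \<mu> * d x y"
      using pen[of "(x, y)"] that by simp
  qed
  have lip: "\<phi> w \<le> \<phi> w' + \<mu> * d w w'" for w w'
  proof -
    have "\<phi> w - \<mu> * d w w' \<le> \<phi> w'"
    proof (subst (2) \<phi>_def, rule cINF_greatest[OF False])
      fix x assume "x \<in> A"
      have "\<mu> * d x w \<le> \<mu> * (d x w' + d w w')"
        using \<mu> d_triangle[of x w w'] d_commute[of w w'] by (intro mult_left_mono) auto
      then show "\<phi> w - \<mu> * d w w' \<le> f x + \<mu> * d x w'"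
        using \<phi>_lower[OF \<open>x \<in> A\<close>, of w] by (simp add: distrib_left)
    qed
    then show ?thesis by simp
  qed
  have "continuous_on UNIV \<phi>"
    unfolding continuous_on_def
  proof
    fix w
    have "((\<lambda>v. \<mu> * d v w) \<longlongrightarrow> \<mu> * d w w) (at w)"
    proof -
      have "continuous_on UNIV (\<lambda>v. \<mu> * d v w)"
        unfolding d_def
        by (intro continuous_on_mult continuous_on_sum continuous_on_rabs continuous_on_diff continuous_on_const continuous_on_coordinate)
      then show ?thesis
        by (simp add: continuous_on_def)
    qed
    then have "((\<lambda>v. \<mu> * d v w) \<longlongrightarrow> 0) (at w)"
      by (simp add: d_self)
    moreover have "\<forall>\<^sub>F v in at w. norm (\<phi> v - \<phi> w) \<le> \<mu> * d v w"
      using lip[of _ w] lip[of w] d_commute[of w]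
      by (intro always_eventually allI) (simp add: abs_le_iff algebra_simps)
    ultimately have "((\<lambda>v. \<phi> v - \<phi> w) \<longlongrightarrow> 0) (at w)"
      by (rule Lim_null_comparison[rotated])
    then show "(\<phi> \<longlongrightarrow> \<phi> w) (at w)"
      by (simp add: LIM_zero_iff)
  qed
  define S where "S = zero_outside W ` (A \<union> B)"
  \<comment> \<open>Entries outside \<open>W\<close> are cleared because polynomials in \<open>W\<close> only separate points that differ there.\<close>
  have "continuous_on (A \<union> B) (zero_outside W)"
  proof (rule continuous_on_coordinatewise_then_product)
    show "continuous_on (A \<union> B) (\<lambda>x. zero_outside W x i)" for i
      by (cases "i \<in> W") (simp_all add: zero_outside_def continuous_on_coordinate)
  qed
  then have "compact S"
    unfolding S_def using A B by (intro compact_continuous_image compact_Un)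
  have "\<exists>q. (\<exists>h\<in>polys_in W. q = peval h) \<and> (\<forall>x\<in>S. \<bar>(\<phi> x - \<delta> / 2) - q x\<bar> < \<delta> / 2)"
  proof (rule Stone_Weierstrass_HOL[OF \<open>compact S\<close>])
    show "\<exists>h\<in>polys_in W. (\<lambda>x. c) = peval h" for c
      by (intro bexI[of _ "Const c"]) (auto simp: peval_hom)
    show "continuous_on S q" if "\<exists>h\<in>polys_in W. q = peval h" for q
      using that continuous_on_peval by auto
    show "\<exists>h\<in>polys_in W. (\<lambda>x. p x + q x) = peval h"
      if "(\<exists>h\<in>polys_in W. p = peval h) \<and> (\<exists>h\<in>polys_in W. q = peval h)" for p q
    proof -
      obtain h h' where "h \<in> polys_in W" "p = peval h" "h' \<in> polys_in W" "q = peval h'"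
        using \<open>_ \<and> _\<close> by blast
      then show ?thesis by (intro bexI[of _ "h + h'"]) (auto simp: peval_hom)
    qed
    show "\<exists>h\<in>polys_in W. (\<lambda>x. p x * q x) = peval h"
      if "(\<exists>h\<in>polys_in W. p = peval h) \<and> (\<exists>h\<in>polys_in W. q = peval h)" for p q
    proof -
      obtain h h' where "h \<in> polys_in W" "p = peval h" "h' \<in> polys_in W" "q = peval h'"
        using \<open>_ \<and> _\<close> by blast
      then show ?thesis by (intro bexI[of _ "h * h'"]) (auto simp: peval_hom)
    qed
    show "\<exists>q. (\<exists>h\<in>polys_in W. q = peval h) \<and> q x \<noteq> q y" if xy: "x \<in> S \<and> y \<in> S \<and> x \<noteq> y" for x y
    proof -
      obtain i where i: "x i \<noteq> y i"
        using xy by blast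
      then have "i \<in> W"
        using xy by (auto simp: S_def zero_outside_def split: if_splits)
      with i show ?thesis
        by (intro exI[of _ "peval (Var i)"]) (auto simp: peval_hom)
    qed
    show "continuous_on S (\<lambda>x. \<phi> x - \<delta> / 2)"
      using \<open>continuous_on UNIV \<phi>\<close> by (intro continuous_on_diff continuous_on_const) (rule continuous_on_subset, auto)
    show "0 < \<delta> / 2" using \<delta> by simp
  qed
  then obtain h where h: "h \<in> polys_in W" "\<And>x. x \<in> S \<Longrightarrow> \<bar>(\<phi> x - \<delta> / 2) - peval h x\<bar> < \<delta> / 2"
    by blast
  have "\<phi> (zero_outside W x) = \<phi> x" for x
    by (simp add: \<phi>_def d_def zero_outside_def)
  then have approx: "\<bar>(\<phi> x - \<delta> / 2) - peval h x\<bar> < \<delta> / 2" if "x \<in> A \<union> B" for x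
    using h(2)[of "zero_outside W x"] that by (simp add: S_def peval_zero_outside[OF h(1)])
  show ?thesis
  proof (intro bexI[OF _ h(1)] conjI ballI)
    show "peval h x < f x" if "x \<in> A" for x
      using approx[OF UnI1[OF that]] \<phi>_A[OF that] by linarith
    show "- g y < peval h y" if "y \<in> B" for y
      using approx[OF UnI2[OF that]] \<phi>_B[OF that] by linarith
  qed
qed

text \<open>
  Induction on the number of blocks. Let \<open>J\<close> be the last block and \<open>V\<close> the union of the others. A
  point of the last ball and a point of the sparse ball of the others that agree on \<open>V \<inter> J\<close> can be
  glued to a point of the whole sparse ball, which is why \<open>separating_polynomial\<close> applies and
  yields \<open>h\<close> in the variables \<open>V \<inter> J\<close>. Then \<open>h\<close> is subtracted from the last summand and added to
  the summand of a block containing \<open>V \<inter> J\<close>.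
\<close>

proposition sparse_positive_split:
  assumes "1 \<le> k" "RIP k I" "\<And>l. l \<in> {1..k} \<Longrightarrow> finite (I l)"
    and "\<And>l. l \<in> {1..k} \<Longrightarrow> q l \<in> polys_in (I l)"
    and "\<And>x. x \<in> sparse_ball k I R \<Longrightarrow> 0 < peval (\<Sum>l = 1..k. q l) x"
  shows "\<exists>q'. (\<Sum>l = 1..k. q' l) = (\<Sum>l = 1..k. q l) \<and>
    (\<forall>l \<in> {1..k}. q' l \<in> polys_in (I l) \<and> (\<forall>x. L2_set x (I l) \<le> R l \<longrightarrow> 0 < peval (q' l) x))"
  using assms
proof (induction k arbitrary: q rule: nat_induct_at_least)
  case base
  then show ?case
    by (intro exI[of _ q]) (auto simp: sparse_ball_def)
next
  case (Suc k)
  define J where "J = I (Suc k)"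
  define V where "V = (\<Union>l \<in> {1..k}. I l)"
  obtain j where j: "1 \<le> j" "j \<le> k" "V \<inter> J \<subseteq> I j"
    using Suc.prems(1) \<open>1 \<le> k\<close> unfolding RIP_def V_def J_def by (metis Suc_eq_plus1 lessI)
  define A where "A = {x. (\<forall>i. i \<notin> J \<longrightarrow> x i = 0) \<and> (\<forall>l\<in>{Suc k}. L2_set x (I l) \<le> R l)}"
  define B where "B = {x. (\<forall>i. i \<notin> V \<longrightarrow> x i = 0) \<and> (\<forall>l\<in>{1..k}. L2_set x (I l) \<le> R l)}"
  define Q where "Q = (\<Sum>l = 1..k. q l)"
  have I_V: "I l \<subseteq> V" if "l \<in> {1..k}" for l
    using that by (auto simp: V_def)
  have Q_polys: "Q \<in> polys_in V"
    unfolding Q_def by (intro polys_in_sum polys_in_mono[OF Suc.prems(3) I_V]) auto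
  have q_polys: "q (Suc k) \<in> polys_in J"
    unfolding J_def using Suc.prems(3) by simp
  have "\<exists>h \<in> polys_in (V \<inter> J). (\<forall>x\<in>A. peval h x < peval (q (Suc k)) x) \<and> (\<forall>y\<in>B. - peval Q y < peval h y)"
  proof (rule separating_polynomial[of A B "peval (q (Suc k))" "peval Q" "V \<inter> J"])
    show "compact A" unfolding A_def
      by (rule compact_sparse_ball) (use Suc.prems(2) in \<open>auto simp: J_def\<close>)
    show "compact B" unfolding B_def
      by (rule compact_sparse_ball) (use Suc.prems(2) in \<open>auto simp: V_def\<close>)
    show "0 < peval (q (Suc k)) x + peval Q y"
      if x: "x \<in> A" and y: "y \<in> B" and eq: "\<And>i. i \<in> V \<inter> J \<Longrightarrow> x i = y i" for x y
    proof -
      \<comment> \<open>Agreement on \<open>V \<inter> J\<close> makes \<open>z\<close> coincide with \<open>y\<close> on all of \<open>V\<close>.\<close>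
      define z where "z = (\<lambda>i. if i \<in> J then x i else y i)"
      have zx: "z i = x i" if "i \<in> J" for i using that by (simp add: z_def)
      have zy: "z i = y i" if "i \<in> V" for i using that eq[of i] by (simp add: z_def)
      have "z \<in> sparse_ball (Suc k) I R"
        unfolding sparse_ball_def
      proof (intro CollectI ballI)
        fix l assume l: "l \<in> {1..Suc k}"
        show "L2_set z (I l) \<le> R l"
        proof (cases "l = Suc k")
          case True
          then have "L2_set z (I l) = L2_set x (I l)"
            using zx by (auto simp: J_def intro!: L2_set_cong)
          with x True show ?thesis by (simp add: A_def)
        next
          case False
          then have "l \<in> {1..k}" using l by auto
          then have "L2_set z (I l) = L2_set y (I l)"
            using zy I_V by (intro L2_set_cong) auto
          with y \<open>l \<in> {1..k}\<close> show ?thesis by (simp add: B_def)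
        qed
      qed
      then have "0 < peval (\<Sum>l = 1..Suc k. q l) z"
        by (rule Suc.prems(4))
      also have "\<dots> = peval Q z + peval (q (Suc k)) z"
        by (simp add: Q_def peval_hom)
      also have "\<dots> = peval Q y + peval (q (Suc k)) x"
        using peval_cong[OF Q_polys zy] peval_cong[OF q_polys zx] by simp
      finally show ?thesis by simp
    qed
    show "finite (V \<inter> J)"
      using Suc.prems(2) by (simp add: J_def)
  qed (rule continuous_on_peval)+
  then obtain h where h: "h \<in> polys_in (V \<inter> J)"
    and hA: "\<And>x. x \<in> A \<Longrightarrow> peval h x < peval (q (Suc k)) x"
    and hB: "\<And>y. y \<in> B \<Longrightarrow> - peval Q y < peval h y"
    by blast
  have sum_upd: "(\<Sum>l = 1..k. (q(j := q j + h)) l) = Q + h"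
  proof -
    have "(\<Sum>l = 1..k. (q(j := q j + h)) l) = (\<Sum>l = 1..k. q l + (if l = j then h else 0))"
      by (rule sum.cong) auto
    also have "\<dots> = Q + h"
      using j by (simp add: sum.distrib Q_def sum.delta)
    finally show ?thesis .
  qed
  have "\<exists>q'. (\<Sum>l = 1..k. q' l) = (\<Sum>l = 1..k. (q(j := q j + h)) l) \<and>
    (\<forall>l \<in> {1..k}. q' l \<in> polys_in (I l) \<and> (\<forall>x. L2_set x (I l) \<le> R l \<longrightarrow> 0 < peval (q' l) x))"
  proof (rule Suc.IH)
    show "RIP k I"
      using Suc.prems(1) by (auto simp: RIP_def)
    show "finite (I l)" if "l \<in> {1..k}" for l
      using Suc.prems(2) that by simp
    show "(q(j := q j + h)) l \<in> polys_in (I l)" if "l \<in> {1..k}" for l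
      using Suc.prems(3)[of l] polys_in_mono[OF h j(3)] that by auto
    fix x assume "x \<in> sparse_ball k I R"
    then have "zero_outside V x \<in> B"
      by (simp add: B_def sparse_ball_def L2_set_zero_outside[OF I_V] zero_outside_eq_0)
    then have "- peval Q (zero_outside V x) < peval h (zero_outside V x)"
      by (rule hB)
    then show "0 < peval (\<Sum>l = 1..k. (q(j := q j + h)) l) x"
      unfolding sum_upd using peval_zero_outside[OF Q_polys, of V x] peval_zero_outside[OF h, of V x]
      by (simp add: peval_hom)
  qed
  then obtain q' where q'_sum: "(\<Sum>l = 1..k. q' l) = Q + h" and
    q': "\<And>l. l \<in> {1..k} \<Longrightarrow> q' l \<in> polys_in (I l)"
      "\<And>l x. l \<in> {1..k} \<Longrightarrow> L2_set x (I l) \<le> R l \<Longrightarrow> 0 < peval (q' l) x"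
    unfolding sum_upd by blast
  show ?case
  proof (intro exI[of _ "q'(Suc k := q (Suc k) - h)"] conjI ballI)
    have "(\<Sum>l = 1..k. (q'(Suc k := q (Suc k) - h)) l) = (\<Sum>l = 1..k. q' l)"
      by (rule sum.cong) auto
    then show "(\<Sum>l = 1..Suc k. (q'(Suc k := q (Suc k) - h)) l) = (\<Sum>l = 1..Suc k. q l)"
      using q'_sum by (simp add: Q_def)
    fix l assume l: "l \<in> {1..Suc k}"
    have hJ: "h \<in> polys_in J"
      using h by (rule polys_in_mono) simp
    show "(q'(Suc k := q (Suc k) - h)) l \<in> polys_in (I l)"
      using q'(1)[of l] l q_polys hJ by (auto simp: J_def)
    have "0 < peval (q (Suc k) - h) x" if "L2_set x J \<le> R (Suc k)" for x
    proof -
      have "zero_outside J x \<in> A"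
        using that by (simp add: A_def J_def[symmetric] L2_set_zero_outside zero_outside_eq_0)
      then have "peval h (zero_outside J x) < peval (q (Suc k)) (zero_outside J x)"
        by (rule hA)
      then show ?thesis
        by (simp add: peval_hom peval_zero_outside[OF q_polys] peval_zero_outside[OF hJ])
    qed
    then show "\<forall>x. L2_set x (I l) \<le> R l \<longrightarrow> 0 < peval ((q'(Suc k := q (Suc k) - h)) l) x"
      using q'(2)[of l] l by (auto simp: J_def)
  qed
qed

section \<open>The sparse representation\<close>

theorem theorem5:
  fixes K :: "nat \<Rightarrow> mpoly set"
    and n k m :: nat
    and I :: "nat \<Rightarrow> nat set"
    and R U :: "nat \<Rightarrow> real"
    and L :: "nat \<Rightarrow> nat"
    and g :: "nat \<Rightarrow> mpoly"
    and p :: mpoly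
  assumes "poly_class K"
    and "\<forall>s. SOMS s \<subseteq> K s"
    and "k_cover n k I"
    and "RIP k I"
    and "\<forall>l \<in> {1..k}. 0 < R l"
    and "\<forall>j \<in> {1..m}. L j \<in> {1..k}"
    and "\<forall>j \<in> {1..m}. g j \<in> polys_in (I (L j))"
    and "\<forall>j \<in> {1..m}. 0 < U j"
    and "\<forall>j \<in> {1..m}. \<forall>x. L2_set x (I (L j)) \<le> R (L j) \<longrightarrow> peval (g j) x \<le> U j"
    and "p \<in> polys_in {1..n}"
    and "sparse k I p"
    and "\<forall>x \<in> sparse_ball k I R. (\<forall>j \<in> {1..m}. 0 \<le> peval (g j) x) \<longrightarrow> 0 < peval p x"
  shows "\<exists>(\<alpha> :: nat \<Rightarrow> nat \<Rightarrow> mpoly) (\<rho> :: nat \<Rightarrow> mpoly).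
    (\<forall>j \<in> {0, 1}. \<forall>l \<in> {1..k}. \<alpha> j l \<in> K (2 * card (I l) + 1)) \<and>
    (\<forall>j \<in> {1..m}. \<rho> j \<in> K 1) \<and>
    p = (\<Sum>l = 1..k. psubst (\<alpha> 0 l) (ball_args (I l) (R l))
           + psubst (\<alpha> 1 l) (ball_args (I l) (R l)) * ball_poly (I l) (R l))
        + (\<Sum>j = 1..m. psubst (\<rho> j) [Const (U j) - g j] * g j)"
proof -
  note SOMS_K = assms(2)[rule_format, THEN subsetD]
  note R = assms(5)[rule_format] and L = assms(6)[rule_format] and g = assms(7)[rule_format]
    and U = assms(8)[rule_format] and gU = assms(9)[rule_format]
  obtain q where q: "\<And>l. l \<in> {1..k} \<Longrightarrow> q l \<in> polys_in (I l)" and p_sum: "p = (\<Sum>l = 1..k. q l)"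
    using assms(11) unfolding sparse_def by blast
  have pos: "0 < peval p x" if "x \<in> sparse_ball k I R" "\<And>j. j \<in> {1..m} \<Longrightarrow> 0 \<le> peval (g j) x" for x
    using assms(12) that by blast
  \<comment> \<open>Without blocks \<open>p\<close> is the empty sum 0 and there are no constraints, contradicting positivity.\<close>
  have "1 \<le> k"
  proof (rule ccontr)
    assume "\<not> 1 \<le> k"
    then have "k = 0" "{1..m} = {}" using L by auto
    then show False
      using pos[of "\<lambda>_. 0"] by (simp add: p_sum sparse_ball_def peval_hom)
  qed
  have cover: "(\<Union>l \<in> {1..k}. I l) = {1..n}"
    using assms(3) by (simp add: k_cover_def)
  have I_sub: "I l \<subseteq> {1..n}" if "l \<in> {1..k}" for l
    using cover that by blast
  have I_fin: "finite (I l)" if "l \<in> {1..k}" for l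
    using I_sub[OF that] finite_subset by blast
  define S where "S = {x. (\<forall>i. i \<notin> {1..n} \<longrightarrow> x i = 0) \<and> (\<forall>l\<in>{1..k}. L2_set x (I l) \<le> R l)}"
  have "compact S"
    unfolding S_def by (rule compact_sparse_ball) (use I_fin cover in auto)
  have "\<exists>c\<ge>0. \<exists>N. \<forall>x\<in>S.
      0 < peval p x - (\<Sum>j\<in>{1..m}. c * (1 - peval (g j) x / U j) ^ (2 * N) * peval (g j) x)"
  proof (rule compact_even_power_penalty[OF \<open>compact S\<close>])
    show "peval (g j) x \<le> U j" if "j \<in> {1..m}" "x \<in> S" for j x
      using gU[OF that(1)] that(2) L[OF that(1)] by (simp add: S_def)
    show "0 < peval p x" if "x \<in> S" "\<And>j. j \<in> {1..m} \<Longrightarrow> 0 \<le> peval (g j) x" for x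
      using that by (intro pos) (auto simp: S_def sparse_ball_def)
  qed (auto intro: U continuous_on_peval)
  then obtain c N where c: "c \<ge> 0" and
    pen: "\<And>x. x \<in> S \<Longrightarrow> 0 < peval p x - (\<Sum>j\<in>{1..m}. c * (1 - peval (g j) x / U j) ^ (2 * N) * peval (g j) x)"
    by blast
  \<comment> \<open>The denominator turns \<open>U\<^sub>j - g\<^sub>j\<close> into \<open>1 - g\<^sub>j / U\<^sub>j\<close>.\<close>
  define \<rho> where "\<rho> = (\<lambda>j. Const (c / U j ^ (2 * N)) * ((Var 1)\<^sup>2) ^ N)"
  have \<rho>: "\<rho> j \<in> SOMS 1" if "j \<in> {1..m}" for j
    unfolding \<rho>_def using c U[OF that]
    by (intro nonneg_semiring_closed[OF nonneg_semiring_SOMS] SOMS_Var_square) auto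
  define \<psi> where "\<psi> = (\<lambda>j. psubst (\<rho> j) [Const (U j) - g j] * g j)"
  have \<psi>_eq: "\<psi> j = Const (c / U j ^ (2 * N)) * ((Const (U j) - g j)\<^sup>2) ^ N * g j" for j
    by (simp add: \<psi>_def \<rho>_def psubst_hom)
  have \<psi>_polys: "\<psi> j \<in> polys_in (I (L j))" if "j \<in> {1..m}" for j
    unfolding \<psi>_eq using g[OF that]
    by (intro polys_in_mult polys_in_power polys_in_diff polys_in_Const)
  have ev_\<psi>: "peval (\<psi> j) x = c * (1 - peval (g j) x / U j) ^ (2 * N) * peval (g j) x" if "j \<in> {1..m}" for j x
  proof -
    have "(1 - peval (g j) x / U j) ^ (2 * N) = (U j - peval (g j) x) ^ (2 * N) / U j ^ (2 * N)"
      using U[OF that] by (simp add: diff_divide_distrib flip: power_divide)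
    then show ?thesis
      by (simp add: \<psi>_eq peval_hom flip: power_mult)
  qed
  \<comment> \<open>Each penalty term is charged to the block that carries its constraint.\<close>
  define q1 where "q1 = (\<lambda>l. q l - (\<Sum>j | j \<in> {1..m} \<and> L j = l. \<psi> j))"
  have q1_polys: "q1 l \<in> polys_in (I l)" if "l \<in> {1..k}" for l
    unfolding q1_def using q[OF that] \<psi>_polys by (intro polys_in_diff polys_in_sum) auto
  have "(\<Sum>l = 1..k. \<Sum>j | j \<in> {1..m} \<and> L j = l. \<psi> j) = (\<Sum>j = 1..m. \<psi> j)"
    by (rule sum.group) (use L in auto)
  then have q1_sum: "(\<Sum>l = 1..k. q1 l) = p - (\<Sum>j = 1..m. \<psi> j)"
    by (simp add: q1_def sum_subtractf p_sum)
  have q1_pos: "0 < peval (\<Sum>l = 1..k. q1 l) x" if x: "x \<in> sparse_ball k I R" for x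
  proof -
    have "zero_outside {1..n} x \<in> S"
      unfolding S_def
    proof (intro CollectI conjI allI impI ballI)
      show "zero_outside {1..n} x i = 0" if "i \<notin> {1..n}" for i
        using that by (rule zero_outside_eq_0)
      show "L2_set (zero_outside {1..n} x) (I l) \<le> R l" if "l \<in> {1..k}" for l
        using x that by (simp only: L2_set_zero_outside[OF I_sub[OF that]] sparse_ball_def mem_Collect_eq)
    qed
    then have "0 < peval (p - (\<Sum>j = 1..m. \<psi> j)) (zero_outside {1..n} x)"
      using pen by (simp add: peval_hom ev_\<psi>)
    moreover have "p - (\<Sum>j = 1..m. \<psi> j) \<in> polys_in {1..n}"
      using assms(10) \<psi>_polys I_sub[OF L] by (intro polys_in_diff polys_in_sum) (auto intro: polys_in_mono)
    ultimately show ?thesis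
      by (simp only: q1_sum peval_zero_outside[OF _ subset_refl])
  qed
  obtain q' where q'_sum: "(\<Sum>l = 1..k. q' l) = (\<Sum>l = 1..k. q1 l)" and
    q': "\<And>l. l \<in> {1..k} \<Longrightarrow> q' l \<in> polys_in (I l)"
      "\<And>l x. l \<in> {1..k} \<Longrightarrow> L2_set x (I l) \<le> R l \<Longrightarrow> 0 < peval (q' l) x"
    using sparse_positive_split[OF \<open>1 \<le> k\<close> assms(4) I_fin q1_polys q1_pos] by blast
  have "\<forall>l\<in>{1..k}. \<exists>ab. fst ab \<in> SOMS (2 * card (I l) + 1) \<and> snd ab \<in> SOMS (2 * card (I l) + 1) \<and>
    q' l = psubst (fst ab) (ball_args (I l) (R l)) + psubst (snd ab) (ball_args (I l) (R l)) * ball_poly (I l) (R l)"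
  proof
    fix l assume l: "l \<in> {1..k}"
    have "q' l \<in> ball_cone (I l) (R l)"
      by (rule positive_on_ball_in_ball_cone[OF I_fin[OF l] R[OF l] q'(1)[OF l] q'(2)[OF l]])
    then show "\<exists>ab. fst ab \<in> SOMS (2 * card (I l) + 1) \<and> snd ab \<in> SOMS (2 * card (I l) + 1) \<and>
      q' l = psubst (fst ab) (ball_args (I l) (R l)) + psubst (snd ab) (ball_args (I l) (R l)) * ball_poly (I l) (R l)"
      unfolding ball_cone_def by auto
  qed
  then obtain ab where ab: "\<And>l. l \<in> {1..k} \<Longrightarrow>
      fst (ab l) \<in> SOMS (2 * card (I l) + 1) \<and> snd (ab l) \<in> SOMS (2 * card (I l) + 1) \<and>
      q' l = psubst (fst (ab l)) (ball_args (I l) (R l)) + psubst (snd (ab l)) (ball_args (I l) (R l)) * ball_poly (I l) (R l)"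
    by metis
  define \<alpha> where "\<alpha> = (\<lambda>j l. if j = (0::nat) then fst (ab l) else snd (ab l))"
  show ?thesis
  proof (intro exI[of _ \<alpha>] exI[of _ \<rho>] conjI)
    show "\<forall>j \<in> {0, 1}. \<forall>l \<in> {1..k}. \<alpha> j l \<in> K (2 * card (I l) + 1)"
      using ab by (auto simp: \<alpha>_def intro!: SOMS_K)
    show "\<forall>j \<in> {1..m}. \<rho> j \<in> K 1"
      using \<rho> by (blast intro: SOMS_K)
    have "p = (\<Sum>l = 1..k. q' l) + (\<Sum>j = 1..m. \<psi> j)"
      unfolding q'_sum q1_sum by simp
    also have "(\<Sum>l = 1..k. q' l) = (\<Sum>l = 1..k. psubst (\<alpha> 0 l) (ball_args (I l) (R l))
           + psubst (\<alpha> 1 l) (ball_args (I l) (R l)) * ball_poly (I l) (R l))"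
      by (rule sum.cong) (use ab in \<open>auto simp: \<alpha>_def\<close>)
    finally show "p = (\<Sum>l = 1..k. psubst (\<alpha> 0 l) (ball_args (I l) (R l))
           + psubst (\<alpha> 1 l) (ball_args (I l) (R l)) * ball_poly (I l) (R l))
        + (\<Sum>j = 1..m. psubst (\<rho> j) [Const (U j) - g j] * g j)"
      by (simp only: \<psi>_def)
  qed
qed

end
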